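(* Let $V$ be a finite dimensional vector space over a field $\mathbb{K}$ of characteristic zero. Suppose $z\in\widehat L(V)$ has non-trivial linear term, i.e. $z\notin\prod_{l>1}(\widehat L(V)\cap V^{\otimes l})$, and $a\in\widehat L(V)$ satisfies $|\exp(a)|=|\exp(z)|\in|\widehat T(V)|$. Then $a=gzg^{-1}$ for some group-like element $g\in\exp(\widehat L(V))$.
   Context: $\widehat T(V)=\prod_{m\ge0}V^{\otimes m}$ is the completed tensor algebra, a complete Hopf algebra with $V$ primitive; $\widehat L(V)$ is the completed free Lie algebra on $V$ (its primitive elements); $\exp(\widehat L(V))$ is the group of group-like elements. $|\widehat T(V)|$ is the quotient by the closure of the span of commutators, with projection $x\mapsto|x|$. *)

theory Defs
  imports Main
begin

text \<open>V is finite dimensional over 'k, identified with the free vector space on a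
finite basis type 'b. The completed tensor algebra is the algebra of noncommutative
formal power series: an element is its family of coefficients on words over 'b.\<close>

type_synonym ('b, 'k) ser = "'b list \<Rightarrow> 'k"

definition ser_zero :: "('b, 'k::field) ser" where
  "ser_zero = (\<lambda>w. 0)"

definition ser_one :: "('b, 'k::field) ser" where
  "ser_one = (\<lambda>w. if w = [] then 1 else 0)"

definition ser_add :: "('b, 'k::field) ser \<Rightarrow> ('b, 'k) ser \<Rightarrow> ('b, 'k) ser" where
  "ser_add f g = (\<lambda>w. f w + g w)"

definition ser_smult :: "'k::field \<Rightarrow> ('b, 'k) ser \<Rightarrow> ('b, 'k) ser" where
  "ser_smult c f = (\<lambda>w. c * f w)"

definition ser_minus :: "('b, 'k::field) ser \<Rightarrow> ('b, 'k) ser \<Rightarrow> ('b, 'k) ser" where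
  "ser_minus f g = (\<lambda>w. f w - g w)"

definition ser_mult :: "('b, 'k::field) ser \<Rightarrow> ('b, 'k) ser \<Rightarrow> ('b, 'k) ser" where
  "ser_mult f g = (\<lambda>w. \<Sum>i\<le>length w. f (take i w) * g (drop i w))"

primrec ser_pow :: "('b, 'k::field) ser \<Rightarrow> nat \<Rightarrow> ('b, 'k) ser" where
  "ser_pow f 0 = ser_one"
| "ser_pow f (Suc n) = ser_mult f (ser_pow f n)"

text \<open>Exponential; for series with zero constant term (e.g. all elements of the
completed free Lie algebra) the coefficient of a word w only receives contributions
from the powers n \<le> length w, so this is exactly \<Sum>n. f^n / n!.\<close>
definition ser_exp :: "('b, 'k::field_char_0) ser \<Rightarrow> ('b, 'k) ser" where
  "ser_exp f = (\<lambda>w. \<Sum>n\<le>length w. ser_pow f n w / fact n)"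

definition ser_bracket :: "('b, 'k::field) ser \<Rightarrow> ('b, 'k) ser \<Rightarrow> ('b, 'k) ser" where
  "ser_bracket f g = ser_minus (ser_mult f g) (ser_mult g f)"

definition letter :: "'b \<Rightarrow> ('b, 'k::field) ser" where
  "letter b = (\<lambda>w. if w = [b] then 1 else 0)"

definition hpart :: "nat \<Rightarrow> ('b, 'k::field) ser \<Rightarrow> ('b, 'k) ser" where
  "hpart m f = (\<lambda>w. if length w = m then f w else 0)"

inductive lie_hom :: "nat \<Rightarrow> ('b, 'k::field) ser \<Rightarrow> bool" where
  lie_zero: "lie_hom m ser_zero"
| lie_letter: "lie_hom 1 (letter b)"
| lie_add: "lie_hom m x \<Longrightarrow> lie_hom m y \<Longrightarrow> lie_hom m (ser_add x y)"
| lie_smult: "lie_hom m x \<Longrightarrow> lie_hom m (ser_smult c x)"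
| lie_br: "lie_hom p x \<Longrightarrow> lie_hom q y \<Longrightarrow> lie_hom (p + q) (ser_bracket x y)"

definition free_lie_hat :: "('b, 'k::field) ser set" where
  "free_lie_hat = {f. \<forall>m. lie_hom m (hpart m f)}"

definition grouplike :: "('b, 'k::field_char_0) ser set" where
  "grouplike = ser_exp ` free_lie_hat"

inductive comm_span :: "('b, 'k::field) ser \<Rightarrow> bool" where
  cs_zero: "comm_span ser_zero"
| cs_comm: "comm_span (ser_bracket x y)"
| cs_add: "comm_span x \<Longrightarrow> comm_span y \<Longrightarrow> comm_span (ser_add x y)"
| cs_smult: "comm_span x \<Longrightarrow> comm_span (ser_smult c x)"

text \<open>Closure in the (degree-adic / product) topology of the completed tensor algebra.\<close>
definition in_closure :: "(('b, 'k) ser \<Rightarrow> bool) \<Rightarrow> ('b, 'k) ser \<Rightarrow> bool" where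
  "in_closure S f \<longleftrightarrow> (\<forall>N. \<exists>c. S c \<and> (\<forall>w. length w \<le> N \<longrightarrow> f w = c w))"

text \<open>|x| = |y| in |T-hat(V)| = T-hat(V) / closure(span of commutators).\<close>
definition cyc_eq :: "('b, 'k::field) ser \<Rightarrow> ('b, 'k) ser \<Rightarrow> bool" where
  "cyc_eq x y \<longleftrightarrow> in_closure comm_span (ser_minus x y)"

end

theory Submission
  imports Defs "HOL-Computational_Algebra.Polynomial"
begin

text \<open>The Adams operation (coproduct followed by product) descends to cyclic words and multiplies
the image of \<open>a^k\<close> by \<open>2^k\<close> for primitive \<open>a\<close>; hence
\<open>|exp a| = |exp z|\<close> forces \<open>|a^k| = |z^k|\<close> for every k. After a linear change of variables the
linear part of z is a letter x. If \<open>a g\<close> and \<open>g z\<close> agree below degree n, with g group-like, then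
their difference u in degree n is a Lie element, and the lowest degree of \<open>|a^k| = |z^k|\<close> gives
\<open>|u x^(k-1)| = 0\<close> for all k. For large k the run of x's marks a place on the circle, so that
\<open>u = [x, v]\<close> for some v. As the centralizer of \<open>x \<otimes> 1 + 1 \<otimes> x\<close> consists of polynomials in
\<open>x \<otimes> 1\<close> and \<open>1 \<otimes> x\<close>, the series v is primitive too, and \<open>exp (-v) g\<close> improves g by one
degree.\<close>

subsection \<open>Series and their coproduct\<close>

text \<open>No computation takes place in the quotient by commutators: its classes are tested by
  functions on words that are invariant under rotation. In a fixed degree, \<open>exp a\<close>
  mixes finitely many powers of \<open>a\<close>; their Adams eigenvalues 2^k are pairwise distinct
  in characteristic zero, so iterating the operation separates them. The powers are what is wanted,
  because a high power of x is the only marker available on a circular word.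

  Lie series and group-like series are handled through their coproducts, as \<open>primitive\<close>
  and \<open>character\<close>. These conditions involve finitely many coefficients at a time and
  pass to products and limits; the Dynkin operator and a logarithm built degree by degree lead back
  to the definitions.

  The equation u = [x, v] determines v only up to a series in x alone. Choosing v with no
  coefficient on any power of x is what makes it primitive. The induction starts with g = 1 in
  degree 2, since the linear parts of a and z agree: a one-letter word has no other rotation. Each
  correction leaves the lower degrees of g alone, so the corrected series converge.\<close>

lemma ser_mult_Nil [simp]: "ser_mult f g [] = f [] * g []"
  by (simp add: ser_mult_def)

text \<open>The series \<open>\<lambda>v. f (b # v)\<close> is the left derivative of
  \<open>f\<close> by the letter \<open>b\<close>. This Leibniz rule turns identities between
  products into inductions on the word in which the left factor stays arbitrary.\<close>

lemma ser_mult_Cons: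
  "ser_mult f g (b # w) = f [] * g (b # w) + ser_mult (\<lambda>v. f (b # v)) g w"
  by (simp add: ser_mult_def sum.atMost_Suc_shift del: sum.atMost_Suc)

lemma ser_mult_add_left: "ser_mult (\<lambda>v. f v + g v) h w = ser_mult f h w + ser_mult g h w"
  by (simp add: ser_mult_def algebra_simps sum.distrib)

lemma ser_mult_add_right: "ser_mult h (\<lambda>v. f v + g v) w = ser_mult h f w + ser_mult h g w"
  by (simp add: ser_mult_def algebra_simps sum.distrib)

lemma ser_mult_diff_left: "ser_mult (\<lambda>v. f v - g v) h w = ser_mult f h w - ser_mult g h w"
  by (simp add: ser_mult_def algebra_simps sum_subtractf)

lemma ser_mult_diff_right: "ser_mult h (\<lambda>v. f v - g v) w = ser_mult h f w - ser_mult h g w"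
  by (simp add: ser_mult_def algebra_simps sum_subtractf)

lemma ser_mult_scale_left: "ser_mult (\<lambda>v. c * f v) h w = c * ser_mult f h w"
  by (simp add: ser_mult_def sum_distrib_left mult.assoc)

lemma ser_mult_scale_right: "ser_mult h (\<lambda>v. c * f v) w = c * ser_mult h f w"
  by (simp add: ser_mult_def sum_distrib_left mult.left_commute)

lemma ser_mult_assoc: "ser_mult (ser_mult f g) h = ser_mult f (ser_mult g h)"
proof
  fix w show "ser_mult (ser_mult f g) h w = ser_mult f (ser_mult g h) w"
    by (induction w arbitrary: f)
      (simp_all add: ser_mult_Cons ser_mult_add_left ser_mult_scale_left algebra_simps)
qed

lemma ser_mult_one_left [simp]: "ser_mult ser_one f = f"
proof
  fix w show "ser_mult ser_one f w = f w"
  proof (cases w)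
    case (Cons b v)
    have "ser_mult (\<lambda>v. ser_one (b # v)) f v = 0"
      by (simp add: ser_mult_def ser_one_def)
    then show ?thesis by (simp add: Cons ser_mult_Cons ser_one_def)
  qed (simp add: ser_one_def)
qed

lemma ser_mult_one_right [simp]: "ser_mult f ser_one = f"
proof
  fix w show "ser_mult f ser_one w = f w"
    by (induction w arbitrary: f) (simp_all add: ser_mult_Cons ser_one_def)
qed

lemma ser_mult_cong:
  assumes "\<And>v. length v \<le> length w \<Longrightarrow> f v = f' v" "\<And>v. length v \<le> length w \<Longrightarrow> g v = g' v"
  shows "ser_mult f g w = ser_mult f' g' w"
  unfolding ser_mult_def using assms by (intro sum.cong) auto

lemma ser_pow_commute: "ser_mult (ser_pow f n) f = ser_mult f (ser_pow f n)"
  by (induction n) (simp_all add: ser_mult_assoc)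

text \<open>\<open>cop f s t\<close> is the coefficient of \<open>s \<otimes> t\<close> in the coproduct of f, that is, the sum of f over
all shuffles of s and t.\<close>

fun cop :: "('b, 'k::field) ser \<Rightarrow> 'b list \<Rightarrow> 'b list \<Rightarrow> 'k" where
  "cop f [] t = f t"
| "cop f (b # s) [] = f (b # s)"
| "cop f (b # s) (c # t) = cop (\<lambda>w. f (b # w)) s (c # t) + cop (\<lambda>w. f (c # w)) (b # s) t"

lemma cop_Nil2 [simp]: "cop f s [] = f s"
  by (cases s) auto

lemma cop_cong:
  assumes "\<And>w. length w = length s + length t \<Longrightarrow> f w = g w"
  shows "cop f s t = cop g s t"
  using assms
proof (induction f s t arbitrary: g rule: cop.induct)
  case (3 f b s c t)
  show ?case
    using "3.IH"(1)[of "\<lambda>w. g (b # w)"] "3.IH"(2)[of "\<lambda>w. g (c # w)"] "3.prems" by simp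
qed simp_all

lemma cop_add: "cop (\<lambda>w. f w + g w) s t = cop f s t + cop g s t"
  by (induction f s t arbitrary: g rule: cop.induct) simp_all

lemma cop_scale: "cop (\<lambda>w. c * f w) s t = c * cop f s t"
  by (induction f s t rule: cop.induct) (simp_all add: algebra_simps)

lemma cop_diff: "cop (\<lambda>w. f w - g w) s t = cop f s t - cop g s t"
  by (induction f s t arbitrary: g rule: cop.induct) simp_all

lemma cop_zero [simp]: "cop (\<lambda>w. 0) s t = 0"
  using cop_scale[of 0 "\<lambda>w. 0"] by simp

lemma cop_sum: "cop (\<lambda>w. \<Sum>i\<in>A. f i w) s t = (\<Sum>i\<in>A. cop (f i) s t)"
  by (induction A rule: infinite_finite_induct) (simp_all add: cop_add)

lemma cop_Cons_right:
  "cop f s (c # t) = cop (\<lambda>w. f (c # w)) s t +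
     (case s of [] \<Rightarrow> 0 | b # s' \<Rightarrow> cop (\<lambda>w. f (b # w)) s' (c # t))"
  by (cases s) simp_all

lemma cop_commute: "cop f s t = cop f t s"
  by (induction f s t rule: cop.induct) simp_all

text \<open>The product of the completed tensor square.\<close>

definition conv2 where
  "conv2 F G s t = (\<Sum>i\<le>length s. \<Sum>j\<le>length t. F (take i s) (take j t) * G (drop i s) (drop j t))"
  for F G :: "'b list \<Rightarrow> 'b list \<Rightarrow> 'k::field"

text \<open>The coproduct is an algebra morphism. The recursion of \<open>cop\<close> shortens
  either word, hence the two nested inductions, and it differentiates \<open>f\<close>, which
  therefore stays arbitrary.\<close>

lemma cop_mult: "cop (ser_mult f g) s t = conv2 (cop f) (cop g) s t"
proof (induction s arbitrary: f t)
  case Nil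
  show ?case by (simp add: conv2_def ser_mult_def)
next
  case (Cons b s)
  note IHs = Cons.IH
  show ?case
  proof (induction t arbitrary: f)
    case Nil
    show ?case by (simp add: conv2_def ser_mult_def)
  next
    case (Cons c t)
    have "cop (ser_mult f g) (b # s) (c # t) = f [] * cop g (b # s) (c # t)
        + conv2 (cop (\<lambda>w. f (b # w))) (cop g) s (c # t)
        + conv2 (cop (\<lambda>w. f (c # w))) (cop g) (b # s) t"
      by (simp add: ser_mult_Cons cop_add cop_scale IHs Cons.IH algebra_simps)
    also have "\<dots> = conv2 (cop f) (cop g) (b # s) (c # t)"
      by (simp add: conv2_def sum.atMost_Suc_shift sum.distrib distrib_right del: sum.atMost_Suc)
    finally show ?case .
  qed
qed

subsection \<open>Primitive series\<close>

text \<open>In the tensor square: the coproduct of \<open>f\<close> is f tensor 1 plus 1 tensor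
  f.\<close>

definition primitive :: "('b, 'k::field) ser \<Rightarrow> bool" where
  "primitive f \<longleftrightarrow> f [] = 0 \<and> (\<forall>s t. s \<noteq> [] \<longrightarrow> t \<noteq> [] \<longrightarrow> cop f s t = 0)"

text \<open>Group-like series, seen as functionals multiplicative for the shuffle product. In this
  form, closure under products and under degreewise limits is a direct computation.\<close>

definition character :: "('b, 'k::field) ser \<Rightarrow> bool" where
  "character g \<longleftrightarrow> g [] = 1 \<and> (\<forall>s t. cop g s t = g s * g t)"

lemma primitive_Nil: "primitive f \<Longrightarrow> f [] = 0"
  by (simp add: primitive_def)

lemma cop_primitive:
  assumes "primitive f"
  shows "cop f s t = (if s = [] then f t else if t = [] then f s else 0)"
  using assms by (auto simp: primitive_def)

lemma primitive_add: "primitive f \<Longrightarrow> primitive g \<Longrightarrow> primitive (\<lambda>w. f w + g w)"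
  by (simp add: primitive_def cop_add)

lemma primitive_scale: "primitive f \<Longrightarrow> primitive (\<lambda>w. c * f w)"
  by (simp add: primitive_def cop_scale)

lemma sum_eq_single:
  fixes g :: "nat \<Rightarrow> 'a::comm_monoid_add"
  assumes "k \<le> n" "\<And>i. i \<le> n \<Longrightarrow> i \<noteq> k \<Longrightarrow> g i = 0"
  shows "(\<Sum>i\<le>n. g i) = g k"
proof -
  have "(\<Sum>i\<le>n. g i) = (\<Sum>i\<in>{k}. g i)"
    using assms by (intro sum.mono_neutral_right) auto
  then show ?thesis by simp
qed

lemma cop_mult_primitive:
  assumes "primitive a"
  shows "cop (ser_mult a f) s t =
    ser_mult a (\<lambda>s'. cop f s' t) s + ser_mult a (\<lambda>t'. cop f s t') t"
proof -
  \<comment> \<open>For \<open>i = j = 0\<close> both summands on the right apply; each is zero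
    because \<open>a [] = 0\<close>.\<close>
  have *: "cop a (take i s) (take j t) * cop f (drop i s) (drop j t) =
      (if j = 0 then a (take i s) * cop f (drop i s) t else 0) +
      (if i = 0 then a (take j t) * cop f s (drop j t) else 0)"
    if "i \<le> length s" "j \<le> length t" for i j
  proof -
    have "take i s = [] \<longleftrightarrow> i = 0" "take j t = [] \<longleftrightarrow> j = 0"
      using that by auto
    then show ?thesis
      using primitive_Nil[OF assms] by (auto simp: cop_primitive[OF assms])
  qed
  have "cop (ser_mult a f) s t = (\<Sum>i\<le>length s. \<Sum>j\<le>length t.
      (if j = 0 then a (take i s) * cop f (drop i s) t else 0) +
      (if i = 0 then a (take j t) * cop f s (drop j t) else 0))"
    unfolding cop_mult conv2_def by (intro sum.cong refl *) auto
  also have "\<dots> = (\<Sum>i\<le>length s. a (take i s) * cop f (drop i s) t)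
       + (\<Sum>j\<le>length t. a (take j t) * cop f s (drop j t))"
  proof -
    have "(\<Sum>i\<le>length s. \<Sum>j\<le>length t. (if i = 0 then a (take j t) * cop f s (drop j t) else 0))
      = (\<Sum>j\<le>length t. \<Sum>i\<le>length s. (if i = 0 then a (take j t) * cop f s (drop j t) else 0))"
      by (rule sum.swap)
    then show ?thesis
      by (simp add: sum.distrib sum.delta)
  qed
  finally show ?thesis by (simp add: ser_mult_def)
qed

lemma cop_mult_primitive_right:
  assumes "primitive a"
  shows "cop (ser_mult f a) s t =
    ser_mult (\<lambda>s'. cop f s' t) a s + ser_mult (\<lambda>t'. cop f s t') a t"
proof -
  have *: "cop f (take i s) (take j t) * cop a (drop i s) (drop j t) =
      (if j = length t then cop f (take i s) t * a (drop i s) else 0) +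
      (if i = length s then cop f s (take j t) * a (drop j t) else 0)"
    if "i \<le> length s" "j \<le> length t" for i j
  proof -
    have "drop i s = [] \<longleftrightarrow> i = length s" "drop j t = [] \<longleftrightarrow> j = length t"
      using that by auto
    then show ?thesis
      using primitive_Nil[OF assms] by (auto simp: cop_primitive[OF assms])
  qed
  have "cop (ser_mult f a) s t = (\<Sum>i\<le>length s. \<Sum>j\<le>length t.
      (if j = length t then cop f (take i s) t * a (drop i s) else 0) +
      (if i = length s then cop f s (take j t) * a (drop j t) else 0))"
    unfolding cop_mult conv2_def by (intro sum.cong refl *) auto
  also have "\<dots> = (\<Sum>i\<le>length s. cop f (take i s) t * a (drop i s))
       + (\<Sum>j\<le>length t. cop f s (take j t) * a (drop j t))"
  proof -
    have "(\<Sum>i\<le>length s. \<Sum>j\<le>length t. (if i = length s then cop f s (take j t) * a (drop j t) else 0))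
      = (\<Sum>j\<le>length t. \<Sum>i\<le>length s. (if i = length s then cop f s (take j t) * a (drop j t) else 0))"
      by (rule sum.swap)
    then show ?thesis
      by (simp add: sum.distrib sum.delta)
  qed
  finally show ?thesis by (simp add: ser_mult_def)
qed

text \<open>The mixed part of the coproduct of the product of \<open>a\<close> and \<open>b\<close>
  is a tensor b plus b tensor a. It is symmetric in the two factors and cancels in the
  commutator.\<close>

lemma primitive_bracket:
  assumes a: "primitive a" and b: "primitive b"
  shows "primitive (ser_bracket a b)"
proof -
  have *: "ser_mult a (\<lambda>s'. cop b s' t) s = a s * b t"
    if "t \<noteq> []" "primitive a" "primitive b" for a b :: "('a, 'b) ser" and s t
  proof -
    have "ser_mult a (\<lambda>s'. cop b s' t) s = a (take (length s) s) * cop b (drop (length s) s) t"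
      unfolding ser_mult_def
      by (rule sum_eq_single) (use that in \<open>auto simp: cop_primitive[OF that(3)]\<close>)
    then show ?thesis by simp
  qed
  have **: "cop (ser_mult a b) s t = a s * b t + a t * b s"
    if "s \<noteq> []" "t \<noteq> []" "primitive a" "primitive b" for a b :: "('a, 'b) ser" and s t
    using *[OF that(2-4), of s] *[OF that(1,3,4), of t] cop_mult_primitive[OF that(3)]
    by (metis (no_types, lifting) cop_commute ser_mult_cong)
  show ?thesis
    unfolding primitive_def
    using **[OF _ _ a b] **[OF _ _ b a] primitive_Nil[OF a] primitive_Nil[OF b]
    by (auto simp: ser_bracket_def ser_minus_def cop_diff algebra_simps)
qed

lemma primitive_letter: "primitive (letter b :: ('b, 'k::field) ser)"
proof -
  have "cop (letter b) s t = (0 :: 'k)" if "s \<noteq> []" "t \<noteq> []" for s t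
  proof -
    have "cop (letter b) s t = cop (\<lambda>w. 0 :: 'k) s t"
      using that by (intro cop_cong) (cases s; cases t; auto simp: letter_def)
    then show ?thesis by simp
  qed
  then show ?thesis by (simp add: primitive_def letter_def)
qed

lemma lie_hom_imp_primitive: "lie_hom m f \<Longrightarrow> primitive f"
proof (induction rule: lie_hom.induct)
  case (lie_zero m)
  then show ?case by (simp add: primitive_def ser_zero_def)
next
  case (lie_letter b)
  then show ?case by (rule primitive_letter)
next
  case (lie_add m x y)
  then show ?case by (simp add: ser_add_def primitive_add)
next
  case (lie_smult m x c)
  then show ?case by (simp add: ser_smult_def primitive_scale)
next
  case (lie_br p x q y)
  then show ?case by (simp add: primitive_bracket)
qed

lemma cop_hpart: "cop (hpart (length s + length t) f) s t = cop f s t"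
  by (rule cop_cong) (simp add: hpart_def)

lemma free_lie_hat_imp_primitive:
  assumes "f \<in> free_lie_hat"
  shows "primitive f"
proof -
  have p: "primitive (hpart m f)" for m
    using assms lie_hom_imp_primitive by (auto simp: free_lie_hat_def)
  have "f [] = 0" using primitive_Nil[OF p[of 0]] by (simp add: hpart_def)
  moreover have "cop f s t = 0" if "s \<noteq> []" "t \<noteq> []" for s t
    using p[of "length s + length t"] that cop_hpart[of s t f] by (simp add: primitive_def)
  ultimately show ?thesis by (simp add: primitive_def)
qed

lemma lie_hom_sum:
  "(\<And>i. i \<in> A \<Longrightarrow> lie_hom m (f i)) \<Longrightarrow> lie_hom m (\<lambda>w. \<Sum>i\<in>A. f i w)"
proof (induction A rule: infinite_finite_induct)
  case (insert x F)
  then have "lie_hom m (ser_add (f x) (\<lambda>w. \<Sum>i\<in>F. f i w))"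
    by (intro lie_add) auto
  then show ?case using insert by (simp add: ser_add_def)
qed (use lie_zero[of m] in \<open>simp_all add: ser_zero_def\<close>)

text \<open>The degree n part of f with every word replaced by its right-normed iterated bracket.\<close>

primrec dynkin :: "nat \<Rightarrow> ('b::finite, 'k::field) ser \<Rightarrow> ('b, 'k) ser" where
  "dynkin 0 f = (\<lambda>w. 0)"
| "dynkin (Suc n) f = (\<lambda>w. \<Sum>b\<in>UNIV. ser_bracket (letter b) (dynkin n (\<lambda>v. f (b # v))) w +
      (if n = 0 then f [b] * letter b w else 0))"

lemma lie_hom_dynkin: "lie_hom n (dynkin n f)"
proof (induction n arbitrary: f)
  case 0
  then show ?case using lie_zero[of 0] by (simp add: ser_zero_def)
next
  case (Suc n)
  have 1: "lie_hom (Suc n) (ser_bracket (letter b) (dynkin n g))" for b and g :: "('a, 'b) ser"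
    using lie_br[OF lie_letter Suc.IH, of b g] by simp
  have 2: "lie_hom (Suc n) (\<lambda>w. if n = 0 then f [b] * letter b w else 0)" for b
    using lie_smult[OF lie_letter, of "f [b]" b] lie_zero[of "Suc n"]
    by (cases "n = 0") (simp_all add: ser_smult_def ser_zero_def)
  show ?case
    unfolding dynkin.simps
    by (rule lie_hom_sum, rule lie_add[OF 1 2, unfolded ser_add_def])
qed

subsection \<open>Primitive series are Lie series\<close>

lemma letter_mult_Cons: "ser_mult (letter b) f (c # w) = (if c = b then f w else 0)"
proof -
  have "ser_mult (\<lambda>v. letter b (c # v)) f w = (if c = b then ser_mult ser_one f w else 0)"
    by (auto simp: letter_def ser_one_def ser_mult_def intro!: sum.cong)
  then show ?thesis by (simp add: ser_mult_Cons letter_def)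
qed

lemma ser_mult_letter_snoc: "ser_mult f (letter b) (w @ [c]) = (if c = b then f w else 0)"
proof (induction w arbitrary: f)
  case Nil
  show ?case by (simp add: ser_mult_Cons letter_def)
next
  case (Cons d w)
  show ?case using Cons.IH[of "\<lambda>v. f (d # v)"] by (simp add: ser_mult_Cons) (simp add: letter_def)
qed

lemma dynkin_cong:
  "(\<And>w. length w = n \<Longrightarrow> f w = g w) \<Longrightarrow> dynkin n f = dynkin n g"
proof (induction n arbitrary: f g)
  case (Suc n)
  have "dynkin n (\<lambda>v. f (b # v)) = dynkin n (\<lambda>v. g (b # v))" for b
    using Suc.prems by (intro Suc.IH) simp
  moreover have "n = 0 \<longrightarrow> f [b] = g [b]" for b
    using Suc.prems by simp
  ultimately show ?case
    by (auto intro!: sum.cong ext)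
qed simp

lemma dynkin_add: "dynkin n (\<lambda>v. f v + g v) w = dynkin n f w + dynkin n g w"
proof (induction n arbitrary: f g w)
  case (Suc n)
  then have "dynkin n (\<lambda>v. f (b # v) + g (b # v)) =
      (\<lambda>w. dynkin n (\<lambda>v. f (b # v)) w + dynkin n (\<lambda>v. g (b # v)) w)" for b
    by auto
  then show ?case
    by (simp add: ser_bracket_def ser_minus_def ser_mult_add_left ser_mult_add_right
        sum.distrib[symmetric]) (auto intro!: sum.cong simp: algebra_simps)
qed simp

lemma dynkin_zero [simp]: "dynkin n (\<lambda>v. 0) w = 0"
proof -
  have "dynkin n (\<lambda>v. 0) w + 0 = dynkin n (\<lambda>v. 0) w + dynkin n (\<lambda>v. 0) w"
    using dynkin_add[of n "\<lambda>v. 0" "\<lambda>v. 0" w] by simp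
  then show ?thesis by (metis add_left_cancel)
qed

text \<open>A bracket with a letter puts it in front or, with a minus sign, at the end; so the
  coefficient looks at the word without its first and without its last letter. The third summand is
  the degree one case.\<close>

lemma dynkin_Suc_Cons:
  "dynkin (Suc i) h (b # q) = dynkin i (\<lambda>v. h (b # v)) q
     - dynkin i (\<lambda>v. h (last (b # q) # v)) (butlast (b # q))
     + (if i = 0 \<and> q = [] then h [b] else 0)"
proof -
  have r: "ser_mult (dynkin i f) (letter c) (b # q) =
      (if c = last (b # q) then dynkin i f (butlast (b # q)) else 0)" for f c
    using ser_mult_letter_snoc[of "dynkin i f" c "butlast (b # q)" "last (b # q)"]
    by (simp del: last.simps butlast.simps)
  show ?thesis
    unfolding dynkin.simps ser_bracket_def ser_minus_def r letter_mult_Cons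
    by (auto simp: sum.distrib sum_subtractf letter_def if_distrib[of "\<lambda>x. _ * x"] cong: if_cong)
qed

text \<open>Induction step of the degree count: one more letter contributes one more copy of the
  coefficient, and all other new terms telescope.\<close>

lemma dynkin_sum_Cons:
  fixes f :: "('b::finite, 'k::field) ser"
  shows "(\<Sum>j\<le>length (b # p). dynkin j (\<lambda>w. cop f w (drop j (b # p))) (take j (b # p))) =
    (\<Sum>j\<le>length p. dynkin j (\<lambda>w. cop (\<lambda>v. f (b # v)) w (drop j p)) (take j p)) + f (b # p)"
proof -
  define p0 where "p0 = b # p"
  define n where "n = length p"
  have len: "length p0 = Suc n" by (simp add: p0_def n_def)
  \<comment> \<open>\<open>A\<close> collects the shuffles that start with a letter of
    \<open>w\<close>, \<open>B\<close> those that start with the first letter \<open>p0 ! j\<close>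
    of the suffix. The guard in \<open>B\<close> matters: for \<open>j = Suc n\<close> the suffix is
    empty.\<close>
  define A where "A j w = (case w of [] \<Rightarrow> 0 | c # v \<Rightarrow> cop (\<lambda>v. f (c # v)) v (drop j p0))" for j w
  define B where "B j w = (if j \<le> n then cop (\<lambda>v. f (p0 ! j # v)) w (drop (Suc j) p0) else 0)" for j w
  have AB: "dynkin j (\<lambda>w. cop f w (drop j p0)) u = dynkin j (A j) u + dynkin j (B j) u"
    if "j \<le> Suc n" for j u
  proof -
    have "cop f w (drop j p0) = A j w + B j w" if "length w = j" for w
    proof (cases "j \<le> n")
      case True
      then have "drop j p0 = p0 ! j # drop (Suc j) p0"
        using len by (simp add: Cons_nth_drop_Suc)
      then show ?thesis
        using True by (auto simp: A_def B_def cop_Cons_right split: list.split)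
    next
      case False
      then have "drop j p0 = []" "j = Suc n" using \<open>j \<le> Suc n\<close> len by auto
      then show ?thesis using that by (cases w) (auto simp: A_def B_def)
    qed
    then have "dynkin j (\<lambda>w. cop f w (drop j p0)) = dynkin j (\<lambda>w. A j w + B j w)"
      by (rule dynkin_cong)
    then show ?thesis by (simp add: dynkin_add)
  qed
  \<comment> \<open>The bracket term that removes the last letter reproduces \<open>B i\<close>, one
    index lower. This is the source of the cancellation.\<close>
  have eqA: "dynkin (Suc i) (A (Suc i)) (take (Suc i) p0) =
      dynkin i (\<lambda>w. cop (\<lambda>v. f (b # v)) w (drop i p)) (take i p)
      - dynkin i (B i) (take i p0) + (if i = 0 then f (b # p) else 0)" if "i \<le> n" for i
  proof -
    have t: "take (Suc i) p0 = b # take i p" by (simp add: p0_def)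
    have l: "last (b # take i p) = p0 ! i"
      unfolding t[symmetric] using that len by (subst last_conv_nth) (auto simp: min_def)
    have bl: "butlast (b # take i p) = take i p0"
      using that len t butlast_take[of "Suc i" p0] by simp
    have q: "take i p = [] \<longleftrightarrow> i = 0" using that by (auto simp: n_def)
    have a1: "(\<lambda>v. A (Suc i) (b # v)) = (\<lambda>w. cop (\<lambda>v. f (b # v)) w (drop i p))"
      by (simp add: A_def p0_def)
    have a2: "(\<lambda>v. A (Suc i) (p0 ! i # v)) = B i"
      using that by (simp add: A_def B_def fun_eq_iff)
    show ?thesis
      unfolding t dynkin_Suc_Cons l bl a1 a2 by (auto simp: q A_def p0_def)
  qed
  have "(\<Sum>j\<le>Suc n. dynkin j (\<lambda>w. cop f w (drop j p0)) (take j p0)) =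
      (\<Sum>j\<le>Suc n. dynkin j (A j) (take j p0)) + (\<Sum>j\<le>Suc n. dynkin j (B j) (take j p0))"
    by (simp add: AB sum.distrib del: sum.atMost_Suc)
  also have "(\<Sum>j\<le>Suc n. dynkin j (B j) (take j p0)) = (\<Sum>j\<le>n. dynkin j (B j) (take j p0))"
  proof -
    have "B (Suc n) = (\<lambda>w. 0)" by (simp add: B_def fun_eq_iff)
    then show ?thesis by (simp del: dynkin.simps)
  qed
  also have "(\<Sum>j\<le>Suc n. dynkin j (A j) (take j p0)) =
      (\<Sum>i\<le>n. dynkin (Suc i) (A (Suc i)) (take (Suc i) p0))"
    by (simp add: sum.atMost_Suc_shift del: sum.atMost_Suc dynkin.simps(2))
  also have "\<dots> = (\<Sum>i\<le>n. dynkin i (\<lambda>w. cop (\<lambda>v. f (b # v)) w (drop i p)) (take i p)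
      - dynkin i (B i) (take i p0) + (if i = 0 then f (b # p) else 0))"
    by (intro sum.cong refl eqA) simp
  also have "\<dots> = (\<Sum>i\<le>n. dynkin i (\<lambda>w. cop (\<lambda>v. f (b # v)) w (drop i p)) (take i p))
      - (\<Sum>i\<le>n. dynkin i (B i) (take i p0)) + f (b # p)"
    by (simp add: sum.distrib sum_subtractf)
  finally show ?thesis by (simp add: len n_def p0_def)
qed

text \<open>The Dynkin operator convolved with the identity is multiplication by the degree.\<close>

lemma dynkin_convolution:
  fixes f :: "('b::finite, 'k::field) ser"
  shows "(\<Sum>j\<le>length p. dynkin j (\<lambda>w. cop f w (drop j p)) (take j p)) = of_nat (length p) * f p"
proof (induction p arbitrary: f)
  case (Cons b p)
  show ?case unfolding dynkin_sum_Cons Cons.IH by (simp add: algebra_simps)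
qed simp

lemma lie_hom_length: "lie_hom m f \<Longrightarrow> length w \<noteq> m \<Longrightarrow> f w = 0"
proof (induction arbitrary: w rule: lie_hom.induct)
  case (lie_br p x q y)
  have *: "ser_mult x y w = 0" "ser_mult y x w = 0"
    unfolding ser_mult_def using lie_br.IH lie_br.prems
    by (intro sum.neutral; auto; metis le_add_diff_inverse length_drop length_take min.absorb2 add.commute)+
  then show ?case by (simp add: ser_bracket_def ser_minus_def)
qed (auto simp: ser_zero_def letter_def ser_add_def ser_smult_def)

text \<open>Dynkin-Specht-Wever theorem. For primitive \<open>f\<close> only the summand of the
  convolution that takes the whole word survives; the one with \<open>j = 0\<close> vanishes because
  \<open>dynkin 0\<close> does.\<close>

lemma dynkin_primitive:
  fixes f :: "('b::finite, 'k::field) ser"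
  assumes "primitive f"
  shows "dynkin n f = (\<lambda>w. of_nat n * hpart n f w)"
proof
  fix p
  show "dynkin n f p = of_nat n * hpart n f p"
  proof (cases "length p = n")
    case False
    then show ?thesis using lie_hom_length[OF lie_hom_dynkin] by (simp add: hpart_def)
  next
    case True
    have "dynkin j (\<lambda>w. cop f w (drop j p)) (take j p) = 0" if "j \<le> n" "j \<noteq> n" for j
    proof -
      have "drop j p \<noteq> []" using that True by auto
      then have "dynkin j (\<lambda>w. cop f w (drop j p)) = dynkin j (\<lambda>w. 0)" if "j \<noteq> 0"
        using that assms by (intro dynkin_cong) (auto simp: primitive_def)
      then show ?thesis by (cases "j = 0") (simp_all del: dynkin.simps(2))
    qed
    then have "(\<Sum>j\<le>n. dynkin j (\<lambda>w. cop f w (drop j p)) (take j p)) =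
        dynkin n (\<lambda>w. cop f w (drop n p)) (take n p)"
      by (intro sum_eq_single) auto
    then show ?thesis using dynkin_convolution[of f p] True by (simp add: hpart_def)
  qed
qed

text \<open>For primitive \<open>f\<close>, the part of degree n > 0 is 1/n times its Dynkin image,
  a combination of iterated brackets. Characteristic zero permits the division.\<close>

lemma primitive_iff_free_lie_hat:
  fixes f :: "('b::finite, 'k::field_char_0) ser"
  shows "f \<in> free_lie_hat \<longleftrightarrow> primitive f"
proof
  assume p: "primitive f"
  have "lie_hom n (hpart n f)" for n
  proof (cases "n = 0")
    case True
    then have "hpart n f = ser_zero"
      using primitive_Nil[OF p] by (auto simp: hpart_def ser_zero_def)
    then show ?thesis by (simp add: lie_zero)
  next
    case False
    then have "hpart n f = ser_smult (1 / of_nat n) (dynkin n f)"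
      by (auto simp: dynkin_primitive[OF p] ser_smult_def)
    then show ?thesis by (metis lie_smult lie_hom_dynkin)
  qed
  then show "f \<in> free_lie_hat" by (simp add: free_lie_hat_def)
qed (rule free_lie_hat_imp_primitive)

subsection \<open>Exponentials and characters\<close>

definition vanish_below :: "nat \<Rightarrow> ('b, 'k::field) ser \<Rightarrow> bool" where
  "vanish_below m f \<longleftrightarrow> (\<forall>w. length w < m \<longrightarrow> f w = 0)"

lemma vanish_below_mult:
  assumes "vanish_below m f" "vanish_below k g"
  shows "vanish_below (m + k) (ser_mult f g)"
  unfolding vanish_below_def ser_mult_def
proof (intro allI impI sum.neutral ballI)
  fix w :: "'a list" and i assume "length w < m + k" "i \<in> {..length w}"
  then have "length (take i w) < m \<or> length (drop i w) < k" by auto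
  then show "f (take i w) * g (drop i w) = 0"
    using assms by (auto simp: vanish_below_def)
qed

lemma ser_mult_lowest:
  assumes "vanish_below m f" "vanish_below k g" "length w = m + k"
  shows "ser_mult f g w = f (take m w) * g (drop m w)"
  unfolding ser_mult_def
proof (rule sum_eq_single)
  fix i assume "i \<le> length w" "i \<noteq> m"
  then have "length (take i w) < m \<or> length (drop i w) < k" using assms(3) by auto
  then show "f (take i w) * g (drop i w) = 0"
    using assms by (auto simp: vanish_below_def)
qed (use assms in simp)

lemma vanish_below_1: "vanish_below 1 f \<longleftrightarrow> f [] = 0"
  by (auto simp: vanish_below_def)

lemma vanish_below_0 [simp]: "vanish_below 0 f"
  by (simp add: vanish_below_def)

lemma vanish_below_pow: "vanish_below m f \<Longrightarrow> vanish_below (n * m) (ser_pow f n)"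
  by (induction n) (simp_all add: vanish_below_mult)

lemma ser_pow_eq_0: "f [] = 0 \<Longrightarrow> length w < n \<Longrightarrow> ser_pow f n w = 0"
  using vanish_below_pow[of 1 f n] by (simp add: vanish_below_1) (simp add: vanish_below_def)

lemma ser_pow_cong:
  "(\<And>v. length v \<le> length w \<Longrightarrow> f v = g v) \<Longrightarrow> ser_pow f n w = ser_pow g n w"
proof (induction n arbitrary: w)
  case (Suc n)
  have "ser_pow f n v = ser_pow g n v" if "length v \<le> length w" for v
    using Suc.prems that by (intro Suc.IH) auto
  then show ?case using Suc.prems by (auto intro: ser_mult_cong)
qed simp

lemma ser_exp_cong:
  "(\<And>v. length v \<le> length w \<Longrightarrow> f v = g v) \<Longrightarrow> ser_exp f w = ser_exp g w"
  unfolding ser_exp_def by (intro sum.cong refl arg_cong2[of _ _ _ _ "(/)"] ser_pow_cong)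

lemma ser_exp_eq:
  assumes "f [] = 0" "length w \<le> N"
  shows "ser_exp f w = (\<Sum>n\<le>N. ser_pow f n w / fact n)"
  unfolding ser_exp_def
  by (rule sum.mono_neutral_left) (use assms in \<open>auto simp: ser_pow_eq_0\<close>)

lemma cop_one: "cop ser_one s t = (ser_one s * ser_one t :: 'k::field)"
proof (cases "s = [] \<or> t = []")
  case False
  have "cop ser_one s t = cop (\<lambda>w. 0 :: 'k) s t"
    using False by (intro cop_cong) (cases s; auto simp: ser_one_def)
  then show ?thesis using False by (simp add: ser_one_def)
qed (auto simp: ser_one_def)

lemma binomial_shift:
  fixes F :: "nat \<Rightarrow> nat \<Rightarrow> 'k::field"
  shows "(\<Sum>i\<le>n. of_nat (n choose i) * F (Suc i) (n - i)) +
     (\<Sum>i\<le>n. of_nat (n choose i) * F i (Suc (n - i))) =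
     (\<Sum>i\<le>Suc n. of_nat (Suc n choose i) * F i (Suc n - i))"
proof -
  have "(\<Sum>i\<le>n. of_nat (n choose i) * F i (Suc (n - i))) =
      (\<Sum>i\<le>Suc n. of_nat (n choose i) * F i (Suc n - i))"
    by (simp add: Suc_diff_le binomial_eq_0)
  then show ?thesis
    by (simp add: sum.atMost_Suc_shift sum.distrib[symmetric] algebra_simps del: sum.atMost_Suc)
qed

lemma ser_mult_sum_right: "ser_mult h (\<lambda>v. \<Sum>i\<in>A. f i v) w = (\<Sum>i\<in>A. ser_mult h (f i) w)"
  unfolding ser_mult_def by (simp add: sum_distrib_left) (rule sum.swap)

lemma ser_mult_sum_left: "ser_mult (\<lambda>v. \<Sum>i\<in>A. f i v) h w = (\<Sum>i\<in>A. ser_mult (f i) h w)"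
  unfolding ser_mult_def by (simp add: sum_distrib_right) (rule sum.swap)

text \<open>Binomial theorem for a tensor 1 plus 1 tensor a, two commuting elements; the induction
  step is Pascal's rule in the form \<open>binomial_shift\<close>.\<close>

lemma cop_pow:
  assumes "primitive a"
  shows "cop (ser_pow a n) s t =
    (\<Sum>i\<le>n. of_nat (n choose i) * (ser_pow a i s * ser_pow a (n - i) t))"
proof (induction n arbitrary: s t)
  case 0
  show ?case by (simp add: cop_one)
next
  case (Suc n)
  have "cop (ser_pow a (Suc n)) s t =
     ser_mult a (\<lambda>s'. \<Sum>i\<le>n. (of_nat (n choose i) * ser_pow a (n - i) t) * ser_pow a i s') s +
     ser_mult a (\<lambda>t'. \<Sum>i\<le>n. (of_nat (n choose i) * ser_pow a i s) * ser_pow a (n - i) t') t"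
    by (simp add: cop_mult_primitive[OF assms] Suc.IH mult_ac)
  also have "\<dots> = (\<Sum>i\<le>n. of_nat (n choose i) * (ser_pow a (Suc i) s * ser_pow a (n - i) t)) +
     (\<Sum>i\<le>n. of_nat (n choose i) * (ser_pow a i s * ser_pow a (Suc (n - i)) t))"
    unfolding ser_mult_sum_right ser_mult_scale_right by (simp add: mult_ac)
  finally show ?case unfolding binomial_shift[of n "\<lambda>i j. ser_pow a i s * ser_pow a j t"] .
qed

lemma character_exp:
  fixes a :: "('b, 'k::field_char_0) ser"
  assumes "primitive a"
  shows "character (ser_exp a)"
proof -
  have a0: "a [] = 0" using assms by (rule primitive_Nil)
  define E where "E i w = ser_pow a i w / fact i" for i w
  have E0: "E i w = 0" if "length w < i" for i w
    using ser_pow_eq_0[of a, OF a0 that] by (simp add: E_def)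
  have "cop (ser_exp a) s t = ser_exp a s * ser_exp a t" for s t
  proof -
    let ?N = "length s + length t"
    have "cop (ser_exp a) s t = cop (\<lambda>w. \<Sum>n\<le>?N. (1 / fact n) * ser_pow a n w) s t"
      by (rule cop_cong) (simp add: ser_exp_def)
    also have "\<dots> = (\<Sum>n\<le>?N. (1 / fact n) * cop (ser_pow a n) s t)"
      unfolding cop_sum cop_scale ..
    also have "\<dots> = (\<Sum>n\<le>?N. \<Sum>i\<le>n. E i s * E (n - i) t)"
    proof (intro sum.cong refl)
      fix n
      have "1 / fact n * (of_nat (n choose i) * x) = x / (fact i * fact (n - i))"
        if "i \<le> n" for i and x :: 'k
        using that by (simp add: binomial_fact field_simps)
      then show "1 / fact n * cop (ser_pow a n) s t = (\<Sum>i\<le>n. E i s * E (n - i) t)"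
        unfolding cop_pow[OF assms] sum_distrib_left
        by (intro sum.cong refl) (simp add: E_def)
    qed
    also have "\<dots> = (\<Sum>(i, j)\<in>{(i, j). i + j \<le> ?N}. E i s * E j t)"
      by (rule sum.triangle_reindex_eq[symmetric])
    \<comment> \<open>As \<open>a\<close> has no constant term, \<open>E i s\<close> vanishes for
      \<open>i > length s\<close>. The triangle thus shrinks to the rectangle over which the product
      of the two exponentials is summed.\<close>
    also have "\<dots> = (\<Sum>(i, j)\<in>{..length s} \<times> {..length t}. E i s * E j t)"
    proof (rule sum.mono_neutral_right)
      have "{(i, j). i + j \<le> ?N} \<subseteq> {..?N} \<times> {..?N}" by auto
      then show "finite {(i, j). i + j \<le> ?N}" by (rule finite_subset) simp
    next
      show "\<forall>p\<in>{(i, j). i + j \<le> ?N} - {..length s} \<times> {..length t}.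
          (case p of (i, j) \<Rightarrow> E i s * E j t) = 0"
      proof
        fix p assume p: "p \<in> {(i, j). i + j \<le> ?N} - {..length s} \<times> {..length t}"
        obtain i j where ij: "p = (i, j)" by (cases p)
        then have "length s < i \<or> length t < j" using p by auto
        then show "(case p of (i, j) \<Rightarrow> E i s * E j t) = 0" using E0 ij by auto
      qed
    qed auto
    also have "\<dots> = ser_exp a s * ser_exp a t"
      by (simp add: ser_exp_def E_def sum_product sum.cartesian_product)
    finally show ?thesis .
  qed
  then show ?thesis by (simp add: character_def) (simp add: ser_exp_def ser_one_def)
qed

lemma character_mult:
  assumes "character f" "character g"
  shows "character (ser_mult f g)"
proof -
  have "cop (ser_mult f g) s t = ser_mult f g s * ser_mult f g t" for s t
    unfolding cop_mult conv2_def unfolding ser_mult_def sum_product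
    by (intro sum.cong refl) (use assms in \<open>simp add: character_def mult_ac\<close>)
  then show ?thesis using assms by (simp add: character_def)
qed

lemma character_one: "character ser_one"
  by (simp add: character_def cop_one) (simp add: ser_one_def)

section \<open>Degreewise limits and logarithms of characters\<close>

lemma primitive_limit:
  assumes "\<And>n. primitive (X n)" "\<And>n w. length w \<le> n \<Longrightarrow> X n w = f w"
  shows "primitive f"
proof -
  have "cop f s t = cop (X (length s + length t)) s t" for s t
    by (rule cop_cong) (simp add: assms(2))
  moreover have "f [] = X 0 []" by (simp add: assms(2))
  ultimately show ?thesis using assms(1) by (auto simp: primitive_def)
qed

lemma character_limit:
  assumes "\<And>n. character (X n)" "\<And>n w. length w \<le> n \<Longrightarrow> X n w = f w"
  shows "character f"
proof -
  have "cop f s t = cop (X (length s + length t)) s t" for s t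
    by (rule cop_cong) (simp add: assms(2))
  moreover have "f [] = X 0 []" by (simp add: assms(2))
  moreover have "X (length s + length t) s = f s" "X (length s + length t) t = f t" for s t
    by (simp_all add: assms(2))
  ultimately show ?thesis using assms(1) by (simp add: character_def)
qed

lemma stable_sequence_limit:
  fixes X :: "nat \<Rightarrow> ('b, 'k) ser"
  assumes "\<And>n w. length w \<le> n \<Longrightarrow> X (Suc n) w = X n w" "length w \<le> n"
  shows "X n w = X (length w) w"
  using assms(2) by (induction n rule: dec_induct) (simp_all add: assms(1))

text \<open>If a character agrees with \<open>exp l\<close> up to degree n, their difference in the next degree is
primitive; this replaces the logarithm.\<close>

lemma character_exp_extend:
  fixes g :: "('b, 'k::field_char_0) ser"
  assumes g: "character g" and l: "primitive l" "\<And>w. length w \<le> n \<Longrightarrow> ser_exp l w = g w"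
  shows "\<exists>l'. primitive l' \<and> (\<forall>w. length w \<le> Suc n \<longrightarrow> ser_exp l' w = g w) \<and>
     (\<forall>w. length w \<le> n \<longrightarrow> l' w = l w)"
proof -
  define d where "d = hpart (Suc n) (\<lambda>w. g w - ser_exp l w)"
  have e: "character (ser_exp l)" by (rule character_exp[OF l(1)])
  have "cop d s t = 0" if "s \<noteq> []" "t \<noteq> []" for s t
  proof (cases "length s + length t = Suc n")
    case True
    moreover have "length s > 0" "length t > 0" using that by auto
    ultimately have "length s \<le> n" "length t \<le> n" by linarith+
    moreover have "cop d s t = cop (\<lambda>w. g w - ser_exp l w) s t"
      unfolding d_def using cop_hpart True by metis
    ultimately show ?thesis using g e l(2) by (simp add: cop_diff character_def)
  next
    case False
    have "cop d s t = cop (\<lambda>w. 0) s t"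
      by (rule cop_cong) (use False in \<open>simp add: d_def hpart_def\<close>)
    then show ?thesis by simp
  qed
  then have d: "primitive d" by (simp add: primitive_def d_def hpart_def)
  define l' where "l' = (\<lambda>w. l w + d w)"
  have l': "primitive l'" unfolding l'_def using l(1) d by (rule primitive_add)
  have eq: "l' w = l w" if "length w \<le> n" for w
    using that by (simp add: l'_def d_def hpart_def)
  have l0: "l [] = 0" "l' [] = 0" using l(1) l' primitive_Nil by auto
  have "ser_exp l' w = g w" if w: "length w = Suc n" for w
  proof -
    \<comment> \<open>Powers other than the first do not notice the change in degree
      \<open>Suc n\<close>: without constant terms, each factor of a product of at least two
      receives at most \<open>n\<close> letters.\<close>
    have p: "ser_pow l' k w = ser_pow l k w" if "k \<noteq> 1" for k
    proof (cases k)
      case (Suc j)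
      then obtain i where j: "j = Suc i" using \<open>k \<noteq> 1\<close> Suc by (cases j) auto
      have 0: "ser_pow l j [] = 0" "ser_pow l' j [] = 0"
        using l0 by (simp_all add: j)
      have "l' (take i w) * ser_pow l' j (drop i w) = l (take i w) * ser_pow l j (drop i w)"
        if i: "i \<le> length w" for i
      proof (cases "i = 0 \<or> i = length w")
        case True
        then show ?thesis using 0 l0 by auto
      next
        case False
        then have "length (take i w) \<le> n" "length (drop i w) \<le> n" using i w by auto
        moreover from this have "ser_pow l' j (drop i w) = ser_pow l j (drop i w)"
          by (intro ser_pow_cong) (simp add: eq)
        ultimately show ?thesis by (simp add: eq)
      qed
      then show ?thesis unfolding Suc ser_pow.simps ser_mult_def by (intro sum.cong) auto
    qed simp
    have "ser_exp l' w - ser_exp l w = (\<Sum>k\<le>Suc n. (ser_pow l' k w - ser_pow l k w) / fact k)"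
      by (simp add: ser_exp_def w sum_subtractf[symmetric] diff_divide_distrib del: sum.atMost_Suc)
    also have "\<dots> = (ser_pow l' 1 w - ser_pow l 1 w) / fact 1"
      by (rule sum_eq_single) (auto simp: p)
    also have "\<dots> = g w - ser_exp l w"
      using w by (simp add: l'_def d_def hpart_def)
    finally show ?thesis by simp
  qed
  moreover have "ser_exp l' w = g w" if "length w \<le> n" for w
    using l(2)[OF that] ser_exp_cong[of w l' l] eq that by auto
  ultimately show ?thesis using l' eq le_Suc_eq by metis
qed

lemma character_imp_exp:
  fixes g :: "('b, 'k::field_char_0) ser"
  assumes g: "character g"
  shows "\<exists>l. primitive l \<and> g = ser_exp l"
proof -
  have "\<exists>X. \<forall>n. (primitive (X n) \<and> (\<forall>w. length w \<le> n \<longrightarrow> ser_exp (X n) w = g w)) \<and>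
      (\<forall>w. length w \<le> n \<longrightarrow> X (Suc n) w = X n w)"
  proof (rule dependent_nat_choice)
    have "primitive ser_zero" by (simp add: primitive_def ser_zero_def)
    moreover have "ser_exp ser_zero [] = g []"
      using g by (simp add: ser_exp_def ser_one_def character_def)
    ultimately show "\<exists>l. primitive l \<and> (\<forall>w. length w \<le> 0 \<longrightarrow> ser_exp l w = g w)" by auto
  next
    fix l n
    assume "primitive l \<and> (\<forall>w. length w \<le> n \<longrightarrow> ser_exp l w = g w)"
    then show "\<exists>l'. (primitive l' \<and> (\<forall>w. length w \<le> Suc n \<longrightarrow> ser_exp l' w = g w)) \<and>
        (\<forall>w. length w \<le> n \<longrightarrow> l' w = l w)"
      using character_exp_extend[OF g] by blast
  qed
  then obtain X where X: "\<And>n. primitive (X n)"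
      "\<And>n w. length w \<le> n \<Longrightarrow> ser_exp (X n) w = g w"
      "\<And>n w. length w \<le> n \<Longrightarrow> X (Suc n) w = X n w"
    by blast
  define l where "l w = X (length w) w" for w
  have lim: "X n w = l w" if "length w \<le> n" for n w
    unfolding l_def using stable_sequence_limit[of X, OF X(3) that] .
  have "g = ser_exp l"
  proof
    fix w
    show "g w = ser_exp l w"
      using X(2)[of w "length w"] ser_exp_cong[of w "X (length w)" l] lim by auto
  qed
  then show ?thesis using primitive_limit[of X, OF X(1) lim] by blast
qed

lemma character_grouplike:
  fixes g :: "('b::finite, 'k::field_char_0) ser"
  shows "character g \<Longrightarrow> g \<in> grouplike"
  using character_imp_exp[of g] primitive_iff_free_lie_hat by (auto simp: grouplike_def)

subsection \<open>Cyclic functionals and Adams operations\<close>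

text \<open>Restricted to words of one length, such a function is a linear functional that vanishes
  on commutators, hence a functional on the quotient.\<close>

definition cyclic :: "('b list \<Rightarrow> 'k) \<Rightarrow> bool" where
  "cyclic \<phi> \<longleftrightarrow> (\<forall>b w. \<phi> (b # w) = \<phi> (w @ [b]))"

definition pairing :: "nat \<Rightarrow> ('b::finite list \<Rightarrow> 'k) \<Rightarrow> ('b, 'k::field) ser \<Rightarrow> 'k" where
  "pairing n \<phi> f = (\<Sum>w | length w = n. \<phi> w * f w)"

lemma cyclic_append: "cyclic \<phi> \<Longrightarrow> \<phi> (u @ v) = \<phi> (v @ u)"
  by (induction u arbitrary: v) (simp_all add: cyclic_def)

lemma finite_words: "finite {w :: 'b::finite list. length w = n}"
  using finite_lists_length_eq[of "UNIV :: 'b set" n] by simp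

lemma finite_word_pairs:
  "finite {(s :: 'b::finite list, t :: 'b list). length s + length t = n}"
proof (rule finite_subset)
  show "{(s :: 'b list, t :: 'b list). length s + length t = n} \<subseteq>
      {s. length s \<le> n} \<times> {s. length s \<le> n}"
    by auto
  show "finite ({s :: 'b list. length s \<le> n} \<times> {s :: 'b list. length s \<le> n})"
    using finite_lists_length_le[of "UNIV :: 'b set" n] by simp
qed

lemma pairing_mult:
  "pairing n \<phi> (ser_mult f g) =
    (\<Sum>(s, t) | length s + length t = n. \<phi> (s @ t) * (f s * g t))"
proof -
  have "pairing n \<phi> (ser_mult f g) =
      (\<Sum>w | length w = n. \<Sum>i\<le>n. \<phi> w * (f (take i w) * g (drop i w)))"
    by (simp add: pairing_def ser_mult_def sum_distrib_left)
  also have "\<dots> = (\<Sum>(w, i)\<in>{w. length w = n} \<times> {..n}. \<phi> w * (f (take i w) * g (drop i w)))"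
    by (simp add: sum.cartesian_product)
  also have "\<dots> = (\<Sum>(s, t) | length s + length t = n. \<phi> (s @ t) * (f s * g t))"
    by (rule sum.reindex_bij_witness[of _ "\<lambda>(s, t). (s @ t, length s)"
          "\<lambda>(w, i). (take i w, drop i w)"]) auto
  finally show ?thesis .
qed

lemma pairing_mult_commute:
  assumes "cyclic \<phi>"
  shows "pairing n \<phi> (ser_mult f g) = pairing n \<phi> (ser_mult g f)"
proof -
  have *: "\<phi> (t @ s) * (g t * f s) = \<phi> (s @ t) * (f s * g t)" for s t
    using cyclic_append[OF assms, of s t] by (simp add: mult_ac)
  show ?thesis
    unfolding pairing_mult
    by (intro sum.reindex_bij_witness[of _ prod.swap prod.swap]) (use * in \<open>simp_all add: split_beta\<close>)
qed

lemma pairing_diff: "pairing n \<phi> (\<lambda>w. f w - g w) = pairing n \<phi> f - pairing n \<phi> g"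
  by (simp add: pairing_def algebra_simps sum_subtractf)

lemma pairing_add: "pairing n \<phi> (\<lambda>w. f w + g w) = pairing n \<phi> f + pairing n \<phi> g"
  by (simp add: pairing_def algebra_simps sum.distrib)

lemma pairing_scale: "pairing n \<phi> (\<lambda>w. c * f w) = c * pairing n \<phi> f"
  by (simp add: pairing_def sum_distrib_left mult_ac)

lemma pairing_cong: "(\<And>w. length w = n \<Longrightarrow> f w = g w) \<Longrightarrow> pairing n \<phi> f = pairing n \<phi> g"
  by (simp add: pairing_def)

lemma pairing_sum: "pairing n \<phi> (\<lambda>w. \<Sum>i\<in>A. f i w) = (\<Sum>i\<in>A. pairing n \<phi> (f i))"
  by (simp add: pairing_def sum_distrib_left) (rule sum.swap)

lemma pairing_comm_span:
  assumes "cyclic \<phi>" "comm_span c"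
  shows "pairing n \<phi> c = 0"
  using assms(2)
proof (induction rule: comm_span.induct)
  case (cs_comm x y)
  then show ?case
    using pairing_mult_commute[OF assms(1), of n x y]
    by (simp add: ser_bracket_def ser_minus_def pairing_diff)
qed (simp_all add: ser_zero_def ser_add_def ser_smult_def pairing_add pairing_scale,
    simp add: pairing_def)

text \<open>The functional reads only words of length \<open>n\<close>, so it is continuous: a
  finite combination of commutators that approximates the difference up to degree \<open>n\<close>
  suffices.\<close>

lemma cyc_eq_pairing:
  assumes "cyclic \<phi>" "cyc_eq f g"
  shows "pairing n \<phi> f = pairing n \<phi> g"
proof -
  obtain c where c: "comm_span c" "\<And>w. length w \<le> n \<Longrightarrow> ser_minus f g w = c w"
    using assms(2) unfolding cyc_eq_def in_closure_def by blast
  have "pairing n \<phi> f - pairing n \<phi> g = pairing n \<phi> (ser_minus f g)"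
    by (simp add: ser_minus_def pairing_diff)
  also have "\<dots> = pairing n \<phi> c"
    by (rule pairing_cong) (simp add: c)
  finally show ?thesis using pairing_comm_span[OF assms(1) c(1)] by simp
qed

text \<open>The sum of \<open>\<theta> s t\<close> over all splittings of the word into complementary subwords s and t.\<close>

primrec unshuffle_sum :: "'b list \<Rightarrow> ('b list \<Rightarrow> 'b list \<Rightarrow> 'k) \<Rightarrow> 'k::field" where
  "unshuffle_sum [] \<theta> = \<theta> [] []"
| "unshuffle_sum (b # w) \<theta> =
    unshuffle_sum w (\<lambda>s t. \<theta> (b # s) t) + unshuffle_sum w (\<lambda>s t. \<theta> s (b # t))"

lemma unshuffle_sum_snoc:
  "unshuffle_sum (w @ [b]) \<theta> =
    unshuffle_sum w (\<lambda>s t. \<theta> (s @ [b]) t) + unshuffle_sum w (\<lambda>s t. \<theta> s (t @ [b]))"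
  by (induction w arbitrary: \<theta>) simp_all

lemma sum_words_Suc:
  fixes h :: "'b::finite list \<Rightarrow> 'k::comm_monoid_add"
  shows "(\<Sum>w | length w = Suc n. h w) = (\<Sum>b\<in>UNIV. \<Sum>w | length w = n. h (b # w))"
  unfolding sum.cartesian_product
  by (rule sum.reindex_bij_witness[of _ "\<lambda>(b, w). b # w" "\<lambda>w. (hd w, tl w)"])
    (auto simp: length_Suc_conv)

lemma sum_word_pairs_fst:
  fixes h :: "'b::finite \<Rightarrow> 'b list \<Rightarrow> 'b list \<Rightarrow> 'k::comm_monoid_add"
  shows "(\<Sum>(s, t) | length s + length t = Suc n. case s of [] \<Rightarrow> 0 | b # s' \<Rightarrow> h b s' t) =
    (\<Sum>b\<in>UNIV. \<Sum>(s, t) | length s + length t = n. h b s t)"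
proof -
  have "(\<Sum>(s, t) | length s + length t = Suc n. case s of [] \<Rightarrow> 0 | b # s' \<Rightarrow> h b s' t) =
      (\<Sum>(s, t) | length s + length t = Suc n \<and> s \<noteq> []. case s of [] \<Rightarrow> 0 | b # s' \<Rightarrow> h b s' t)"
    by (rule sum.mono_neutral_right[OF finite_word_pairs]) (auto split: list.split)
  also have "\<dots> = (\<Sum>b\<in>UNIV. \<Sum>(s, t) | length s + length t = n. h b s t)"
    unfolding sum.cartesian_product
    by (rule sum.reindex_bij_witness[of _ "\<lambda>(b, s, t). (b # s, t)" "\<lambda>(s, t). (hd s, tl s, t)"])
      (auto simp: neq_Nil_conv)
  finally show ?thesis .
qed

lemma sum_word_pairs_snd:
  fixes h :: "'b::finite \<Rightarrow> 'b list \<Rightarrow> 'b list \<Rightarrow> 'k::comm_monoid_add"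
  shows "(\<Sum>(s, t) | length s + length t = Suc n. case t of [] \<Rightarrow> 0 | b # t' \<Rightarrow> h b s t') =
    (\<Sum>b\<in>UNIV. \<Sum>(s, t) | length s + length t = n. h b s t)"
proof -
  have "(\<Sum>(s, t) | length s + length t = Suc n. case t of [] \<Rightarrow> 0 | b # t' \<Rightarrow> h b s t') =
      (\<Sum>(s, t) | length s + length t = Suc n. case s of [] \<Rightarrow> 0 | b # s' \<Rightarrow> h b t s')"
    by (rule sum.reindex_bij_witness[of _ prod.swap prod.swap]) auto
  also have "\<dots> = (\<Sum>b\<in>UNIV. \<Sum>(s, t) | length s + length t = n. h b t s)"
    by (rule sum_word_pairs_fst)
  also have "\<dots> = (\<Sum>b\<in>UNIV. \<Sum>(s, t) | length s + length t = n. h b s t)"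
    by (intro sum.cong refl sum.reindex_bij_witness[of _ prod.swap prod.swap]) auto
  finally show ?thesis .
qed

text \<open>Unshuffling is the transpose of the coproduct. The first letter of the word goes to
  \<open>s\<close> or to \<open>t\<close>, matching the two ways in which a shuffle can
  begin.\<close>

lemma pairing_unshuffle_sum:
  "pairing n (\<lambda>w. unshuffle_sum w \<theta>) f = (\<Sum>(s, t) | length s + length t = n. \<theta> s t * cop f s t)"
proof (induction n arbitrary: \<theta> f)
  case 0
  have "{(s :: 'a list, t :: 'a list). s = [] \<and> t = []} = {([], [])}" by auto
  then show ?case by (simp add: pairing_def)
next
  case (Suc n)
  let ?d = "\<lambda>b v. f (b # v)"
  have "pairing (Suc n) (\<lambda>w. unshuffle_sum w \<theta>) f =
      (\<Sum>b\<in>UNIV. pairing n (\<lambda>w. unshuffle_sum w (\<lambda>s t. \<theta> (b # s) t)) (?d b)) +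
      (\<Sum>b\<in>UNIV. pairing n (\<lambda>w. unshuffle_sum w (\<lambda>s t. \<theta> s (b # t))) (?d b))"
    by (simp add: pairing_def sum_words_Suc distrib_right sum.distrib)
  also have "\<dots> =
      (\<Sum>b\<in>UNIV. \<Sum>(s, t) | length s + length t = n. \<theta> (b # s) t * cop (?d b) s t) +
      (\<Sum>b\<in>UNIV. \<Sum>(s, t) | length s + length t = n. \<theta> s (b # t) * cop (?d b) s t)"
    by (simp only: Suc.IH)
  also have "\<dots> = (\<Sum>(s, t) | length s + length t = Suc n. \<theta> s t * cop f s t)"
    unfolding sum_word_pairs_fst[where n = n and h = "\<lambda>b s t. \<theta> (b # s) t * cop (?d b) s t", symmetric]
      sum_word_pairs_snd[where n = n and h = "\<lambda>b s t. \<theta> s (b # t) * cop (?d b) s t", symmetric]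
      sum.distrib[symmetric]
    by (intro sum.cong refl)
      (auto simp: cop_Cons_right distrib_left split: list.split)
  finally show ?case .
qed

definition adams :: "('b list \<Rightarrow> 'k::field) \<Rightarrow> 'b list \<Rightarrow> 'k" where
  "adams \<phi> w = unshuffle_sum w (\<lambda>s t. \<phi> (s @ t))"

text \<open>Moving the first letter of a word to its end exchanges the two parts of an unshuffle to which
the letter may go.\<close>

lemma cyclic_adams:
  assumes "cyclic \<phi>"
  shows "cyclic (adams \<phi>)"
proof -
  have "\<phi> (b # s @ t) = \<phi> (s @ t @ [b])" for b s t
    using assms by (simp add: cyclic_def)
  then show ?thesis by (simp add: cyclic_def adams_def unshuffle_sum_snoc)
qed

lemma ser_pow_add: "ser_mult (ser_pow a i) (ser_pow a j) = ser_pow a (i + j)"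
  by (induction i) (simp_all add: ser_mult_assoc)

text \<open>The coproduct splits a^k binomially, and concatenation multiplies every summand back to
  a^k; the binomial coefficients add up to 2^k.\<close>

lemma pairing_adams_pow:
  assumes "primitive a"
  shows "pairing n (adams \<phi>) (ser_pow a k) = 2 ^ k * pairing n \<phi> (ser_pow a k)"
proof -
  have "pairing n (adams \<phi>) (ser_pow a k) = (\<Sum>(s, t) | length s + length t = n.
      \<Sum>i\<le>k. of_nat (k choose i) * (\<phi> (s @ t) * (ser_pow a i s * ser_pow a (k - i) t)))"
    unfolding adams_def pairing_unshuffle_sum cop_pow[OF assms] sum_distrib_left
    by (simp add: mult_ac)
  also have "\<dots> = (\<Sum>i\<le>k. of_nat (k choose i) * (\<Sum>(s, t) | length s + length t = n.
      \<phi> (s @ t) * (ser_pow a i s * ser_pow a (k - i) t)))"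
    unfolding sum_distrib_left case_prod_beta by (rule sum.swap)
  also have "\<dots> = (\<Sum>i\<le>k. of_nat (k choose i) * pairing n \<phi> (ser_pow a k))"
    unfolding pairing_mult[symmetric] by (intro sum.cong refl) (simp add: ser_pow_add)
  also have "\<dots> = of_nat (\<Sum>i\<le>k. k choose i) * pairing n \<phi> (ser_pow a k)"
    by (simp add: sum_distrib_right)
  finally show ?thesis by (simp add: choose_row_sum)
qed

section \<open>Separating the powers inside the exponential\<close>

lemma pairing_exp:
  assumes "a [] = 0"
  shows "pairing n \<phi> (ser_exp a) = (\<Sum>k\<le>n. pairing n \<phi> (ser_pow a k) / fact k)"
proof -
  have "pairing n \<phi> (ser_exp a) = pairing n \<phi> (\<lambda>w. \<Sum>k\<le>n. (1 / fact k) * ser_pow a k w)"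
    by (rule pairing_cong) (simp add: ser_exp_def)
  then show ?thesis by (simp only: pairing_sum pairing_scale) simp
qed

text \<open>A Vandermonde argument: the polynomial with coefficients \<open>d k\<close> has all
  \<open>2 ^ j\<close> among its roots, and these are infinitely many in characteristic
  zero.\<close>

lemma powers_of_two_independent:
  fixes d :: "nat \<Rightarrow> 'k::field_char_0"
  assumes "\<And>j. (\<Sum>k\<le>n. (2 ^ k) ^ j * d k) = 0" "k \<le> n"
  shows "d k = 0"
proof -
  define p where "p = (\<Sum>k\<le>n. monom (d k) k)"
  have "poly p (2 ^ j) = 0" for j :: nat
    using assms(1)[of j] by (simp add: p_def poly_sum poly_monom power_mult[symmetric] mult_ac)
  then have sub: "range (\<lambda>j::nat. (2::'k) ^ j) \<subseteq> {x. poly p x = 0}" by auto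
  have "inj (\<lambda>j::nat. (2::'k) ^ j)"
  proof (rule injI)
    fix i j :: nat assume "(2::'k) ^ i = 2 ^ j"
    then have "of_nat (2 ^ i) = (of_nat (2 ^ j) :: 'k)" by simp
    then show "i = j" by (simp only: of_nat_eq_iff) simp
  qed
  then have "infinite (range (\<lambda>j::nat. (2::'k) ^ j))" using finite_imageD by blast
  then have "p = 0" using sub poly_roots_finite[of p] finite_subset by blast
  then have "coeff p k = 0" by simp
  then show ?thesis using assms(2) by (simp add: p_def coeff_sum)
qed

text \<open>Every Adams iterate of \<open>\<phi>\<close> is cyclic, so it does not distinguish the
  two exponentials. The \<open>j\<close>-th iterate weights the \<open>k\<close>-th power by
  \<open>(2 ^ k) ^ j\<close>, and varying \<open>j\<close> isolates each \<open>k\<close>. For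
  \<open>k > n\<close> both powers vanish in degree \<open>n\<close>.\<close>

lemma pairing_pow_eq:
  fixes a z :: "('b::finite, 'k::field_char_0) ser"
  assumes a: "primitive a" and z: "primitive z" and \<phi>: "cyclic \<phi>"
    and eq: "cyc_eq (ser_exp a) (ser_exp z)"
  shows "pairing n \<phi> (ser_pow a k) = pairing n \<phi> (ser_pow z k)"
proof (cases "k \<le> n")
  case True
  have cyc: "cyclic ((adams ^^ j) \<phi>)" for j
    by (induction j) (simp_all add: \<phi> cyclic_adams)
  have pow: "pairing n ((adams ^^ j) \<phi>) (ser_pow f k) = (2 ^ k) ^ j * pairing n \<phi> (ser_pow f k)"
    if "primitive f" for j k f
    by (induction j) (simp_all add: pairing_adams_pow[OF that] mult_ac)
  have exp: "pairing n ((adams ^^ j) \<phi>) (ser_exp f) =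
      (\<Sum>k\<le>n. (2 ^ k) ^ j * (pairing n \<phi> (ser_pow f k) / fact k))" if "primitive f" for f j
    by (simp add: pairing_exp primitive_Nil[OF that] pow[OF that])
  have "(\<Sum>k\<le>n. (2 ^ k) ^ j *
      (pairing n \<phi> (ser_pow a k) / fact k - pairing n \<phi> (ser_pow z k) / fact k)) = 0" for j
    using cyc_eq_pairing[OF cyc eq, of n j] unfolding exp[OF a] exp[OF z]
    by (simp add: right_diff_distrib sum_subtractf)
  from powers_of_two_independent[OF this True] show ?thesis by simp
next
  case False
  then have "pairing n \<phi> (ser_pow f k) = 0" if "primitive f" for f
    using primitive_Nil[OF that] by (simp add: pairing_def ser_pow_eq_0)
  then show ?thesis using a z by simp
qed

subsection \<open>Commutators with a letter\<close>

text \<open>Source of test functionals: any function becomes cyclic when summed over rotations. It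
  will be applied to the indicator of a single word.\<close>

lemma cyclic_rotation_sum: "cyclic (\<lambda>w. \<Sum>r<length w. \<theta> (rotate r w))"
  for \<theta> :: "'b list \<Rightarrow> 'k::field"
  unfolding cyclic_def
proof (intro allI)
  fix b :: 'b and w
  define R where "R r = \<theta> (rotate r (b # w))" for r
  have "rotate r (w @ [b]) = rotate (Suc r) (b # w)" for r
    using rotate1_rotate_swap[of r "b # w"] by (metis rotate1.simps(2) rotate_Suc)
  moreover have "R (Suc (length w)) = R 0"
    unfolding R_def using rotate_id[of "Suc (length w)" "b # w"] by (simp del: rotate_Suc)
  moreover have "(\<Sum>r<Suc (length w). R r) = R 0 + (\<Sum>r<length w. R (Suc r))"
    by (rule sum.lessThan_Suc_shift)
  ultimately show "(\<Sum>r<length (b # w). \<theta> (rotate r (b # w))) =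
      (\<Sum>r<length (w @ [b]). \<theta> (rotate r (w @ [b])))"
    unfolding R_def by (simp del: rotate_Suc)
qed

text \<open>The run of \<open>k\<close> letters \<open>x\<close> is at least as long as
  \<open>p\<close>, hence as \<open>q\<close>, so it marks a place on the circle. Only a cut of
  \<open>p\<close> directly after an initial block of \<open>x\<close> brings \<open>q\<close> to
  the front.\<close>

lemma rotate_long_run_iff:
  assumes q: "q \<noteq> []" "hd q \<noteq> x" "last q \<noteq> x"
    and len: "length p = length q + m" "r < length p + k" "length p \<le> k"
  shows "rotate r (p @ replicate k x) = q @ replicate (m + k) x \<longleftrightarrow>
    r \<le> m \<and> p = replicate r x @ q @ replicate (m - r) x"
proof
  assume eq: "rotate r (p @ replicate k x) = q @ replicate (m + k) x"
  have eq': "drop r (p @ replicate k x) @ take r (p @ replicate k x) = q @ replicate (m + k) x"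
    using eq len(2) by (simp add: rotate_drop_take)
  \<comment> \<open>A cut inside the long run would make \<open>q\<close> begin with
    \<open>x\<close>.\<close>
  have r: "r < length p"
  proof (rule ccontr)
    assume "\<not> r < length p"
    then have "hd (q @ replicate (m + k) x) = x"
      unfolding eq'[symmetric] using len by (simp add: hd_append)
    then show False using q by simp
  qed
  then have eq'': "drop r p @ replicate k x @ take r p = q @ replicate (m + k) x"
    using eq' by simp
  \<comment> \<open>A cut too far to the right would place the last letter of \<open>q\<close>
    inside the long run.\<close>
  have rm: "r \<le> m"
  proof (rule ccontr)
    assume "\<not> r \<le> m"
    then have *: "length p - r \<le> length q - 1" "length q - 1 - (length p - r) < k"
      using len r q(1) by (cases q; simp)+
    have "(drop r p @ replicate k x @ take r p) ! (length q - 1) = x"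
      using * by (simp add: nth_append)
    moreover have "(q @ replicate (m + k) x) ! (length q - 1) = last q"
      using q(1) by (simp add: nth_append last_conv_nth)
    ultimately show False using eq'' q(3) by simp
  qed
  have "drop r p = take (length p - r) (drop r p @ replicate k x @ take r p)" by simp
  also have "\<dots> = q @ replicate (m - r) x"
    unfolding eq'' using len rm by simp
  finally have D: "drop r p = q @ replicate (m - r) x" .
  have "take r p = drop (length p - r + k) (drop r p @ replicate k x @ take r p)"
    using r by simp
  also have "\<dots> = replicate r x"
    unfolding eq'' using len rm by simp
  finally have "take r p = replicate r x" .
  then show "r \<le> m \<and> p = replicate r x @ q @ replicate (m - r) x"
    using D rm append_take_drop_id[of r p] by simp
next
  assume "r \<le> m \<and> p = replicate r x @ q @ replicate (m - r) x"
  then show "rotate r (p @ replicate k x) = q @ replicate (m + k) x"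
    using rotate_append[of "replicate r x" "q @ replicate (m - r) x @ replicate k x"]
    by (simp add: replicate_add[symmetric])
qed

lemma run_sum_eq_0:
  fixes u :: "('b::finite, 'k::field) ser"
  assumes u: "\<And>\<phi>. cyclic \<phi> \<Longrightarrow> (\<Sum>p | length p = n. \<phi> (p @ replicate n x) * u p) = 0"
    and q: "q \<noteq> []" "hd q \<noteq> x" "last q \<noteq> x" and n: "n = length q + m"
  shows "(\<Sum>r\<le>m. u (replicate r x @ q @ replicate (m - r) x)) = 0"
proof -
  \<comment> \<open>One representative of a circular word. Summed over rotations, its indicator
    selects from \<open>u\<close> exactly the words x^r q x^(m-r), one for each
    \<open>r \<le> m\<close>.\<close>
  define \<theta> :: "'b list \<Rightarrow> 'k" where "\<theta> w = (if w = q @ replicate (m + n) x then 1 else 0)" for w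
  let ?P = "\<lambda>r. replicate r x @ q @ replicate (m - r) x"
  have "0 = (\<Sum>p | length p = n. (\<Sum>r<length (p @ replicate n x). \<theta> (rotate r (p @ replicate n x))) * u p)"
    using u[OF cyclic_rotation_sum[of \<theta>]] by simp
  also have "\<dots> = (\<Sum>p | length p = n. \<Sum>r<n + n. if r \<le> m \<and> p = ?P r then u p else 0)"
  proof (intro sum.cong refl)
    fix p :: "'b list" assume "p \<in> {p. length p = n}"
    then have p: "length p = n" by simp
    show "(\<Sum>r<length (p @ replicate n x). \<theta> (rotate r (p @ replicate n x))) * u p =
        (\<Sum>r<n + n. if r \<le> m \<and> p = ?P r then u p else 0)"
      unfolding sum_distrib_right
      by (intro sum.cong) (use p n in \<open>auto simp: \<theta>_def rotate_long_run_iff[OF q]\<close>)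
  qed
  also have "\<dots> = (\<Sum>r<n + n. \<Sum>p | length p = n. if r \<le> m \<and> p = ?P r then u p else 0)"
    by (rule sum.swap)
  also have "\<dots> = (\<Sum>r<n + n. if r \<le> m then u (?P r) else 0)"
  proof (intro sum.cong refl)
    fix r
    have "(\<Sum>p | length p = n. if p = ?P r then u p else 0) = u (?P r)" if "r \<le> m"
      by (subst sum.delta[OF finite_words]) (use that n in simp)
    then show "(\<Sum>p | length p = n. if r \<le> m \<and> p = ?P r then u p else 0) =
        (if r \<le> m then u (?P r) else 0)"
      by (cases "r \<le> m") simp_all
  qed
  also have "\<dots> = (\<Sum>r\<le>m. u (?P r))"
  proof -
    have "{..<n + n} \<inter> {r. r \<le> m} = {..m}" using n q(1) by (cases q) auto
    then show ?thesis by (simp add: sum.If_cases)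
  qed
  finally show ?thesis by simp
qed

lemma trailing_run_cases:
  obtains i where "w = replicate i x"
  | q m where "w = q @ replicate m x" "q \<noteq> []" "last q \<noteq> x"
proof (induction w arbitrary: thesis rule: rev_induct)
  case Nil
  then show ?case by (metis replicate_0)
next
  case (snoc c w)
  show ?case
  proof (cases "c = x")
    case True
    show ?thesis
    proof (rule snoc.IH)
      fix i assume "w = replicate i x"
      then show thesis using True snoc.prems(1)[of "Suc i"] by (simp add: replicate_append_same)
    next
      fix q m assume "w = q @ replicate m x" "q \<noteq> []" "last q \<noteq> x"
      then show thesis using True snoc.prems(2)[of q "Suc m"] by (simp add: replicate_append_same)
    qed
  next
    case False
    then show ?thesis using snoc.prems(2)[of "w @ [c]" 0] by simp
  qed
qed

text \<open>Read [x, v] = u at each word. At \<open>x # p\<close> it gives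
  \<open>v p = u (x # p)\<close>, plus \<open>v (x # p')\<close> if \<open>p = p' @ [x]\<close>: a
  recursion for \<open>v\<close>. At words that do not begin with \<open>x\<close> it becomes the
  compatibility condition \<open>run\<close>, and at powers of \<open>x\<close> the condition
  \<open>pw\<close>.\<close>

lemma bracket_letter_solvable:
  fixes u :: "('b, 'k::field) ser"
  assumes pw: "\<And>i. u (replicate i x) = 0"
    and run: "\<And>q m. q \<noteq> [] \<Longrightarrow> hd q \<noteq> x \<Longrightarrow> last q \<noteq> x \<Longrightarrow>
      (\<Sum>r\<le>m. u (replicate r x @ q @ replicate (m - r) x)) = 0"
    and hom: "\<And>w. length w \<noteq> Suc n \<Longrightarrow> u w = 0"
  obtains v where "ser_bracket (letter x) v = u" "\<And>i. v (replicate i x) = 0"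
    "\<And>w. length w \<noteq> n \<Longrightarrow> v w = 0"
proof -
  \<comment> \<open>The recursion unwound: the letters of the final run of \<open>x\<close> move to
    the front one by one. The test keeps those \<open>j\<close> for which the last \<open>j\<close>
    letters all equal \<open>x\<close>.\<close>
  define v where "v p = (\<Sum>j\<le>length p. if drop (length p - j) p = replicate j x
      then u (replicate (Suc j) x @ take (length p - j) p) else 0)" for p
  have v_hom: "v w = 0" if "length w \<noteq> n" for w
    unfolding v_def by (intro sum.neutral ballI) (use that in \<open>auto intro!: hom\<close>)
  have v_pow: "v (replicate i x) = 0" for i
  proof -
    have "replicate (Suc j) x @ take (i - j) (replicate i x) = replicate (Suc i) x" if "j \<le> i" for j
      using that by (simp add: replicate_add[symmetric])
    then have "u (replicate (Suc j) x @ take (i - j) (replicate i x)) = 0" if "j \<le> i" for j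
      using that pw by (metis)
    then show ?thesis unfolding v_def by (intro sum.neutral) auto
  qed
  have v_run: "v (q @ replicate m x) = (\<Sum>j\<le>m. u (replicate (Suc j) x @ q @ replicate (m - j) x))"
    if q: "q \<noteq> []" "last q \<noteq> x" for q m
  proof -
    let ?p = "q @ replicate m x"
    have 1: "drop (length ?p - j) ?p = replicate j x" "take (length ?p - j) ?p = q @ replicate (m - j) x"
      if "j \<le> m" for j
      using that by simp_all
    have 2: "drop (length ?p - j) ?p \<noteq> replicate j x" if "m < j" "j \<le> length ?p" for j
    proof
      assume eq: "drop (length ?p - j) ?p = replicate j x"
      have "drop (length q - (j - m)) q \<noteq> []" using that q by auto
      then have "last q \<in> set (drop (length q - (j - m)) q)"
        by (metis last_drop last_in_set drop_all not_le)
      moreover have "drop (length ?p - j) ?p = drop (length q - (j - m)) q @ replicate m x"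
        using that by (simp add: add.commute)
      ultimately have "last q \<in> set (replicate j x)" using eq by (metis in_set_conv_decomp append_Cons append_assoc)
      then show False using q by simp
    qed
    have m: "m \<le> length ?p" by simp
    have "v ?p = (\<Sum>j\<le>m. if drop (length ?p - j) ?p = replicate j x
      then u (replicate (Suc j) x @ take (length ?p - j) ?p) else 0)"
      unfolding v_def
      by (rule sum.mono_neutral_right) (use 2 m in \<open>auto simp: not_le simp del: drop_append take_append length_append\<close>)
    also have "\<dots> = (\<Sum>j\<le>m. u (replicate (Suc j) x @ q @ replicate (m - j) x))"
      by (intro sum.cong refl) (use 1 in \<open>simp del: drop_append take_append length_append replicate.simps\<close>)
    finally show ?thesis .
  qed
  have br: "ser_bracket (letter x) v w = u w" for w
  proof (cases w rule: trailing_run_cases[of _ x])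
    case (1 i)
    show ?thesis
    proof (cases i)
      case 0
      then show ?thesis using 1 pw[of 0] by (simp add: ser_bracket_def ser_minus_def letter_def)
    next
      case (Suc j)
      have w: "w = x # replicate j x" "w = replicate j x @ [x]"
        using 1 Suc by (simp_all add: replicate_append_same)
      have "ser_mult (letter x) v w = v (replicate j x)" unfolding w(1) by (simp add: letter_mult_Cons)
      moreover have "ser_mult v (letter x) w = v (replicate j x)"
        unfolding w(2) by (simp add: ser_mult_letter_snoc)
      ultimately show ?thesis using pw[of i] 1 by (simp add: ser_bracket_def ser_minus_def)
    qed
  next
    case (2 q m)
    have R: "ser_mult v (letter x) w =
        (case m of 0 \<Rightarrow> 0 | Suc m' \<Rightarrow> \<Sum>j\<le>m'. u (replicate (Suc j) x @ q @ replicate (m' - j) x))"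
    proof (cases m)
      case 0
      then have "w = butlast q @ [last q]" using 2 by simp
      then show ?thesis using 0 2(3) ser_mult_letter_snoc[of v x "butlast q" "last q"] by simp
    next
      case (Suc m')
      then have "w = (q @ replicate m' x) @ [x]" using 2 by (simp add: replicate_append_same)
      then have "ser_mult v (letter x) w = v (q @ replicate m' x)"
        by (simp only: ser_mult_letter_snoc refl if_True)
      then show ?thesis using Suc v_run[OF 2(2,3)] by simp
    qed
    obtain c q' where q: "q = c # q'" using 2(2) by (cases q) auto
    show ?thesis
    proof (cases "c = x")
      case True
      then have q': "q' \<noteq> []" "last q' \<noteq> x" using 2(3) q by (auto split: if_splits)
      have "ser_mult (letter x) v w = (\<Sum>j\<le>m. u (replicate (Suc j) x @ q' @ replicate (m - j) x))"
        using 2 q True v_run[OF q'] by (simp add: letter_mult_Cons)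
      then show ?thesis
        using R 2 q True
        by (cases m) (simp_all add: ser_bracket_def ser_minus_def sum.atMost_Suc_shift
            replicate_app_Cons_same del: sum.atMost_Suc)
    next
      \<comment> \<open>Only the product with \<open>x\<close> on the right contributes, and the
        equation is \<open>run\<close> with its term \<open>r = 0\<close> split off.\<close>
      case False
      then have "ser_mult (letter x) v w = 0" using 2 q by (simp add: letter_mult_Cons)
      moreover have "(\<Sum>r\<le>m. u (replicate r x @ q @ replicate (m - r) x)) = 0"
        using run[of q m] 2 q False by simp
      ultimately show ?thesis
        using R 2
        by (cases m) (simp_all add: ser_bracket_def ser_minus_def sum.atMost_Suc_shift
            neg_eq_iff_add_eq_0 add.commute del: sum.atMost_Suc)
    qed
  qed
  have "ser_bracket (letter x) v = u" by (rule ext) (rule br)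
  from that[of v, OF this v_pow v_hom] show thesis .
qed

section \<open>Primitivity of the solution of [x, v] = u\<close>

lemma cop_replicate_eq_0:
  fixes f :: "('b, 'k::field) ser"
  assumes "\<And>i. f (replicate i x) = 0"
  shows "cop f (replicate i x) (replicate j x) = 0"
  using assms
proof (induction i arbitrary: f j)
  case 0
  then show ?case by simp
next
  case (Suc i)
  note IH = Suc.IH
  have "cop f (replicate (Suc i) x) (replicate j x) = 0" if "\<And>i. f (replicate i x) = 0" for f :: "('b, 'k) ser"
    using that
  proof (induction j arbitrary: f)
    case 0
    show ?case using 0[of "Suc i"] by simp
  next
    case (Suc j)
    have "(\<lambda>w. f (x # w)) (replicate k x) = 0" for k using Suc.prems[of "Suc k"] by simp
    then show ?case using IH[of "\<lambda>w. f (x # w)" "Suc j"] Suc.IH[of "\<lambda>w. f (x # w)"] by simp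
  qed
  then show ?case using Suc.prems by blast
qed

text \<open>The reduced coproduct of \<open>v\<close> commutes with x tensor 1 plus 1 tensor x, so
  it lives on pairs of powers of \<open>x\<close>. All shuffles of such a pair are powers of
  \<open>x\<close>, where \<open>v\<close> vanishes by \<open>pw\<close>. That normalisation
  excludes summands such as x^2, which commute with \<open>x\<close> but are not primitive.\<close>

lemma primitive_of_bracket_letter:
  fixes v :: "('b, 'k::field) ser"
  assumes br: "primitive (ser_bracket (letter x) v)" and pw: "\<And>i. v (replicate i x) = 0"
  shows "primitive v"
proof -
  let ?l = "letter x :: ('b, 'k) ser"
  have rel: "ser_mult ?l (\<lambda>s'. cop v s' t) s + ser_mult ?l (\<lambda>t'. cop v s t') t =
      ser_mult (\<lambda>s'. cop v s' t) ?l s + ser_mult (\<lambda>t'. cop v s t') ?l t"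
    if "s \<noteq> []" "t \<noteq> []" for s t
    using br that cop_mult_primitive[OF primitive_letter[of x], of v s t]
      cop_mult_primitive_right[OF primitive_letter[of x], of v s t]
    by (simp add: primitive_def ser_bracket_def ser_minus_def cop_diff)
  \<comment> \<open>The relation at \<open>(x # s, t)\<close> expresses \<open>cop v s t\<close> by values of the same total degree
    whose first word has a longer initial run of x.\<close>
  have left: "cop v s t = 0" if "t \<noteq> []" "\<exists>c\<in>set s. c \<noteq> x" for s t
    using that
  proof (induction "length s + length t - length (takeWhile (\<lambda>c. c = x) s)"
      arbitrary: s t rule: less_induct)
    case less
    let ?lead = "\<lambda>s. length (takeWhile (\<lambda>c. c = x) s)"
    have lead: "?lead s < length s" if "\<exists>c\<in>set s. c \<noteq> x" for s
      using that by (induction s) auto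
    obtain s0 c where s0: "s = s0 @ [c]" using less.prems(2) by (cases s rule: rev_cases) auto
    obtain t0 d where t0: "t = t0 @ [d]" using less.prems(1) by (cases t rule: rev_cases) auto
    obtain e t1 where t1: "t = e # t1" using less.prems(1) by (cases t) auto
    have A: "cop v (x # s) t' = 0" if "length t = Suc (length t')" "t' \<noteq> []" for t'
      using less.hyps[of "x # s" t'] lead[OF less.prems(2)] less.prems that by simp
    have B: "ser_mult (\<lambda>s'. cop v s' t) ?l (x # s) = 0"
    proof (cases "c = x")
      case True
      have ex: "\<exists>c\<in>set s0. c \<noteq> x" using True less.prems(2) s0 by auto
      then have ld: "?lead s = ?lead s0" unfolding s0 by (auto simp: takeWhile_append1)
      have "cop v (x # s0) t = 0"
        using less.hyps[of "x # s0" t] lead[OF ex] ld less.prems(1) ex s0 by simp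
      then show ?thesis
        using ser_mult_letter_snoc[of "\<lambda>s'. cop v s' t" x "x # s0" c] s0 by simp
    next
      case False
      then show ?thesis
        using ser_mult_letter_snoc[of "\<lambda>s'. cop v s' t" x "x # s0" c] s0 by simp
    qed
    \<comment> \<open>If \<open>t\<close> is a single letter, \<open>t'\<close> is empty and the
      induction hypothesis says nothing; but then both sides are the same term. For longer
      \<open>t\<close> both vanish.\<close>
    have C: "ser_mult ?l (\<lambda>t'. cop v (x # s) t') t = ser_mult (\<lambda>t'. cop v (x # s) t') ?l t"
    proof (cases "t1 = []")
      case True
      then show ?thesis using ser_mult_letter_snoc[of "\<lambda>t'. cop v (x # s) t'" x "[]" e] t1
        by (simp add: letter_mult_Cons)
    next
      case False
      then have "t0 \<noteq> []" using t0 t1 by auto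
      moreover have "length t = Suc (length t0)" "length t = Suc (length t1)"
        using t0 t1 by (simp, metis length_Cons)
      ultimately have "cop v (x # s) t0 = 0" "cop v (x # s) t1 = 0"
        using A[of t0] A[of t1] False by blast+
      then show ?thesis unfolding t0
        by (metis (no_types, lifting) letter_mult_Cons ser_mult_letter_snoc t0 t1)
    qed
    show "cop v s t = 0"
      using rel[of "x # s" t] less.prems(1) B C by (simp add: letter_mult_Cons)
  qed
  have "cop v s t = 0" if "s \<noteq> []" "t \<noteq> []" for s t
  proof -
    consider "\<exists>c\<in>set s. c \<noteq> x" | "\<exists>c\<in>set t. c \<noteq> x"
      | "s = replicate (length s) x" "t = replicate (length t) x"
      by (metis replicate_length_same)
    then show ?thesis
    proof cases
      case 1
      then show ?thesis using left that by blast
    next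
      case 2
      then show ?thesis using left that cop_commute by metis
    next
      case 3
      then show ?thesis using cop_replicate_eq_0[of v x] pw by metis
    qed
  qed
  then show ?thesis using pw[of 0] by (simp add: primitive_def)
qed

subsection \<open>Conjugation degree by degree\<close>

lemmas ser_mult_linear =
  ext[OF ser_mult_add_left] ext[OF ser_mult_add_right]
  ext[OF ser_mult_diff_left] ext[OF ser_mult_diff_right]

text \<open>Says that \<open>f\<close> is x^m plus terms of higher degree. For \<open>m = 0\<close>
  this means constant term 1, so inverses of characters fit the same pattern as powers of
  \<open>a\<close> and \<open>z\<close>.\<close>

definition leading_power :: "'b \<Rightarrow> nat \<Rightarrow> ('b, 'k::field) ser \<Rightarrow> bool" where
  "leading_power x m f \<longleftrightarrow>
    (\<forall>w. length w \<le> m \<longrightarrow> f w = (if w = replicate m x then 1 else 0))"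

lemma leading_power_vanish: "leading_power x m f \<Longrightarrow> vanish_below m f"
  by (auto simp: leading_power_def vanish_below_def)

lemma leading_power_0: "leading_power x 0 f \<longleftrightarrow> f [] = 1"
  by (auto simp: leading_power_def)

lemma leading_power_mult:
  assumes f: "leading_power x m f" and g: "leading_power x k g"
  shows "leading_power x (m + k) (ser_mult f g)"
  unfolding leading_power_def
proof (intro allI impI)
  fix w :: "'a list" assume le: "length w \<le> m + k"
  note v = leading_power_vanish[OF f] leading_power_vanish[OF g]
  show "ser_mult f g w = (if w = replicate (m + k) x then 1 else 0)"
  proof (cases "length w = m + k")
    case True
    have "w = replicate (m + k) x \<longleftrightarrow> take m w = replicate m x \<and> drop m w = replicate k x"
      by (metis append_take_drop_id replicate_add diff_add_inverse drop_replicate le_add1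
          min.absorb1 take_replicate)
    then show ?thesis
      using ser_mult_lowest[OF v True] f g True by (simp add: leading_power_def)
  next
    case False
    then show ?thesis using vanish_below_mult[OF v] le by (auto simp: vanish_below_def)
  qed
qed

lemma leading_power_pow: "leading_power x 1 f \<Longrightarrow> leading_power x k (ser_pow f k)"
proof (induction k)
  case 0
  then show ?case by (simp add: leading_power_0 ser_one_def)
next
  case (Suc k)
  then show ?case using leading_power_mult[of x 1 f k "ser_pow f k"] by simp
qed

text \<open>Geometric series in 1 - f, which is a finite sum on each word since 1 - f has no
  constant term.\<close>

lemma ser_inverse_exists:
  assumes "f [] = 1"
  obtains h where "ser_mult f h = ser_one" "ser_mult h f = ser_one" "h [] = 1"
proof -
  define c where "c = (\<lambda>w. ser_one w - f w)"
  have c0: "c [] = 0" by (simp add: c_def assms ser_one_def)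
  have f: "f = (\<lambda>w. ser_one w - c w)" by (simp add: c_def)
  define h where "h w = (\<Sum>n\<le>length w. ser_pow c n w)" for w
  have h: "h w = (\<Sum>n\<le>N. ser_pow c n w)" if "length w \<le> N" for w N
    unfolding h_def by (rule sum.mono_neutral_left) (use that c0 in \<open>auto simp: ser_pow_eq_0\<close>)
  have tele: "(\<Sum>n\<le>length w. ser_pow c n w) - (\<Sum>n\<le>length w. ser_pow c (Suc n) w) = ser_one w" for w
  proof -
    have "(\<Sum>n\<le>length w. ser_pow c n w - ser_pow c (Suc n) w) =
        ser_pow c 0 w - ser_pow c (Suc (length w)) w"
      by (rule sum_telescope)
    then show ?thesis using ser_pow_eq_0[of c w "Suc (length w)"] c0
      by (simp add: sum_subtractf del: ser_pow.simps(2))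
  qed
  have "ser_mult c h w = (\<Sum>n\<le>length w. ser_pow c (Suc n) w)" for w
  proof -
    have "ser_mult c h w = ser_mult c (\<lambda>v. \<Sum>n\<le>length w. ser_pow c n v) w"
      by (rule ser_mult_cong) (auto intro: h)
    then show ?thesis by (simp add: ser_mult_sum_right)
  qed
  then have "ser_mult f h w = ser_one w" for w
    unfolding f by (simp add: ser_mult_diff_left h_def tele[unfolded ser_pow.simps])
  moreover have "ser_mult h c w = (\<Sum>n\<le>length w. ser_pow c (Suc n) w)" for w
  proof -
    have "ser_mult h c w = ser_mult (\<lambda>v. \<Sum>n\<le>length w. ser_pow c n v) c w"
      by (rule ser_mult_cong) (auto intro: h)
    then show ?thesis by (simp add: ser_mult_sum_left ser_pow_commute)
  qed
  then have "ser_mult h f w = ser_one w" for w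
    unfolding f by (simp add: ser_mult_diff_right h_def tele[unfolded ser_pow.simps])
  moreover have "h [] = 1" by (simp add: h_def ser_one_def)
  ultimately show thesis using that[of h] by blast
qed

lemma pairing_mult_lowest:
  fixes y :: "('b::finite, 'k::field) ser"
  assumes y: "vanish_below n y" and f: "leading_power x m f"
  shows "pairing (n + m) \<phi> (ser_mult y f) = (\<Sum>p | length p = n. \<phi> (p @ replicate m x) * y p)"
proof -
  let ?e = "\<lambda>p. p @ replicate m x"
  have low: "ser_mult y f w = (if drop n w = replicate m x then y (take n w) else 0)"
    if "length w = n + m" for w
    using ser_mult_lowest[OF y leading_power_vanish[OF f] that] f that
    by (simp add: leading_power_def)
  have "pairing (n + m) \<phi> (ser_mult y f) = (\<Sum>w\<in>?e ` {p. length p = n}. \<phi> w * ser_mult y f w)"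
    unfolding pairing_def
  proof (rule sum.mono_neutral_right[OF finite_words])
    show "\<forall>w\<in>{w. length w = n + m} - ?e ` {p. length p = n}. \<phi> w * ser_mult y f w = 0"
    proof
      fix w assume w: "w \<in> {w. length w = n + m} - ?e ` {p. length p = n}"
      have "drop n w \<noteq> replicate m x"
      proof
        assume "drop n w = replicate m x"
        then have "w = ?e (take n w)" by (metis append_take_drop_id)
        moreover have "take n w \<in> {p. length p = n}" using w by simp
        ultimately show False using w by blast
      qed
      then show "\<phi> w * ser_mult y f w = 0" using w by (simp add: low)
    qed
  qed auto
  also have "\<dots> = (\<Sum>p | length p = n. \<phi> (?e p) * ser_mult y f (?e p))"
    by (subst sum.reindex) (auto simp: inj_on_def)
  also have "\<dots> = (\<Sum>p | length p = n. \<phi> (?e p) * y p)"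
    by (intro sum.cong refl) (simp add: low)
  finally show ?thesis .
qed

text \<open>Telescoping \<open>a^k G - G z^k\<close> and using cyclicity gives k equal lowest-degree terms.\<close>

lemma conjugation_defect_pairing:
  fixes a z G :: "('b::finite, 'k::field_char_0) ser"
  assumes a: "leading_power x 1 a" and z: "leading_power x 1 z" and G: "G [] = 1"
    and y: "vanish_below n (\<lambda>w. ser_mult a G w - ser_mult G z w)"
    and pow: "\<And>k m. pairing m \<phi> (ser_pow a k) = pairing m \<phi> (ser_pow z k)"
    and \<phi>: "cyclic \<phi>"
  shows "(\<Sum>p | length p = n. \<phi> (p @ replicate j x) * (ser_mult a G p - ser_mult G z p)) = 0"
proof -
  define Y where "Y = (\<lambda>w. ser_mult a G w - ser_mult G z w)"
  define D where "D k = (\<lambda>w. ser_mult (ser_pow a k) G w - ser_mult G (ser_pow z k) w)" for k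
  define S where "S i = (\<Sum>p | length p = n. \<phi> (p @ replicate i x) * Y p)" for i
  have D_Suc: "ser_mult (D (Suc k)) f =
      (\<lambda>w. ser_mult a (ser_mult (D k) f) w + ser_mult Y (ser_mult (ser_pow z k) f) w)" for k f
    by (simp add: D_def Y_def ser_mult_linear ser_mult_assoc fun_eq_iff)
  \<comment> \<open>The free right factor \<open>f\<close> carries the induction: cyclicity moves
    the leading \<open>a\<close> to the right end, where \<open>f\<close> absorbs it, while the
    total power \<open>i\<close> of \<open>x\<close> beside \<open>Y\<close> stays fixed.\<close>
  have tele: "pairing (n + i) \<phi> (ser_mult (D k) f) = of_nat k * S i"
    if "leading_power x m f" "Suc i = k + m" for k m i f
    using that
  proof (induction k arbitrary: m f)
    case 0
    have "D 0 = (\<lambda>w. 0)" by (simp add: D_def)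
    then show ?case by (simp add: ser_mult_def pairing_def)
  next
    case (Suc k)
    have f': "leading_power x (Suc m) (ser_mult f a)"
      using leading_power_mult[OF Suc.prems(1) a] by simp
    have "pairing (n + i) \<phi> (ser_mult a (ser_mult (D k) f)) =
        pairing (n + i) \<phi> (ser_mult (D k) (ser_mult f a))"
      using pairing_mult_commute[OF \<phi>, of "n + i" a] by (simp add: ser_mult_assoc)
    also have "\<dots> = of_nat k * S i"
      using Suc.IH[OF f'] Suc.prems(2) by simp
    finally have 1: "pairing (n + i) \<phi> (ser_mult a (ser_mult (D k) f)) = of_nat k * S i" .
    have "i = k + m" using Suc.prems(2) by simp
    then have 2: "pairing (n + i) \<phi> (ser_mult Y (ser_mult (ser_pow z k) f)) = S i"
      using pairing_mult_lowest[of n Y x "k + m" "ser_mult (ser_pow z k) f" \<phi>] y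
        leading_power_mult[OF leading_power_pow[OF z, of k] Suc.prems(1)]
      by (simp add: S_def Y_def)
    show ?case by (simp add: D_Suc pairing_add 1 2) (simp add: algebra_simps)
  qed
  \<comment> \<open>With the inverse of \<open>G\<close> on the right, \<open>D k\<close> becomes
    a^k minus a conjugate of z^k, on which cyclic functionals vanish. The remaining factor
    \<open>Suc j\<close> is invertible in characteristic zero.\<close>
  obtain H where H: "ser_mult G H = ser_one" "ser_mult H G = ser_one" "H [] = 1"
    using ser_inverse_exists[of G] G by blast
  have "pairing m \<phi> (ser_mult G (ser_mult (ser_pow z k) H)) = pairing m \<phi> (ser_pow z k)" for m k
    using pairing_mult_commute[OF \<phi>, of m G] by (simp add: ser_mult_assoc H)
  then have "pairing m \<phi> (ser_mult (D k) H) = 0" for m k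
    by (simp add: D_def ser_mult_linear ser_mult_assoc H pairing_diff pow)
  then have "of_nat (Suc j) * S j = 0"
    using tele[of 0 H j "Suc j"] H by (simp add: leading_power_0)
  then show ?thesis by (simp add: S_def Y_def del: of_nat_Suc)
qed

text \<open>Since the coproduct of \<open>G\<close> is G tensor G, the defect Y has coproduct Y
  tensor G plus G tensor Y. Below the lowest degree of Y both terms vanish, which makes its lowest
  part primitive.\<close>

lemma cop_conjugation_defect:
  assumes a: "primitive a" and z: "primitive z" and G: "character G"
  shows "cop (\<lambda>w. ser_mult a G w - ser_mult G z w) s t =
    (ser_mult a G s - ser_mult G z s) * G t + G s * (ser_mult a G t - ser_mult G z t)"
proof -
  have G': "cop G s t = G s * G t" for s t using G by (simp add: character_def)
  have 1: "ser_mult f (\<lambda>s'. G s' * c) s = ser_mult f G s * c"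
    "ser_mult (\<lambda>s'. G s' * c) f s = ser_mult G f s * c" for f c s
    using ser_mult_scale_right[of f c G s] ser_mult_scale_left[of c G f s] by (simp_all add: mult_ac)
  show ?thesis
    unfolding cop_diff cop_mult_primitive[OF a] cop_mult_primitive_right[OF z] G' 1
      ser_mult_scale_left ser_mult_scale_right
    by (simp add: algebra_simps)
qed

lemma primitive_conjugation_defect:
  assumes a: "primitive a" and z: "primitive z" and G: "character G"
    and y: "vanish_below n (\<lambda>w. ser_mult a G w - ser_mult G z w)"
  shows "primitive (hpart n (\<lambda>w. ser_mult a G w - ser_mult G z w))"
proof -
  let ?Y = "\<lambda>w. ser_mult a G w - ser_mult G z w"
  have "cop (hpart n ?Y) s t = 0" if "s \<noteq> []" "t \<noteq> []" for s t
  proof (cases "length s + length t = n")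
    case True
    moreover have "length s > 0" "length t > 0" using that by auto
    ultimately have "length s < n" "length t < n" by linarith+
    then have "?Y s = 0" "?Y t = 0" using y unfolding vanish_below_def by blast+
    then have "cop ?Y s t = 0" by (simp add: cop_conjugation_defect[OF a z G])
    then show ?thesis using cop_hpart[of s t ?Y] True by simp
  next
    case False
    have "cop (hpart n ?Y) s t = cop (\<lambda>w. 0) s t"
      by (rule cop_cong) (use False in \<open>simp add: hpart_def\<close>)
    then show ?thesis by simp
  qed
  moreover have "?Y [] = 0" using primitive_Nil[OF a] primitive_Nil[OF z] by simp
  ultimately show ?thesis by (auto simp: primitive_def hpart_def)
qed

text \<open>Shuffling one \<open>x\<close> into x^j yields the same word \<open>j + 1\<close> times,
  a nonzero multiple in characteristic zero.\<close>

lemma primitive_power_eq_0: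
  fixes u :: "('b, 'k::field_char_0) ser"
  assumes "primitive u" "i \<noteq> 1"
  shows "u (replicate i x) = 0"
proof -
  have *: "cop f [x] (replicate j x) = of_nat (Suc j) * f (replicate (Suc j) x)"
    for f :: "('b, 'k) ser" and j
    by (induction j arbitrary: f) (simp_all add: algebra_simps)
  consider "i = 0" | j where "i = Suc (Suc j)" using assms(2) by (metis One_nat_def not0_implies_Suc)
  then show ?thesis
  proof cases
    case 1
    then show ?thesis using primitive_Nil[OF assms(1)] by simp
  next
    case 2
    have "replicate (Suc j) x \<noteq> []" by simp
    then have "cop u [x] (replicate (Suc j) x) = 0" using assms(1) unfolding primitive_def by blast
    then show ?thesis unfolding * 2 by (simp del: of_nat_Suc replicate.simps)
  qed
qed

lemma ser_exp_linear_part: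
  fixes c :: "('b, 'k::field_char_0) ser"
  assumes "vanish_below m c" "m \<ge> 1" "length w < 2 * m"
  shows "ser_exp c w = ser_one w + c w"
proof -
  have "c [] = 0" using assms by (auto simp: vanish_below_def)
  then have "ser_exp c w = (\<Sum>k\<le>Suc (length w). ser_pow c k w / fact k)"
    by (rule ser_exp_eq) simp
  also have "\<dots> = (\<Sum>k\<in>{0, 1}. ser_pow c k w / fact k)"
  proof (rule sum.mono_neutral_right)
    show "\<forall>k\<in>{..Suc (length w)} - {0, 1}. ser_pow c k w / fact k = 0"
    proof
      fix k assume "k \<in> {..Suc (length w)} - {0, 1}"
      then have "2 * m \<le> k * m" by auto
      then have "length w < k * m" using assms(3) by linarith
      then show "ser_pow c k w / fact k = 0"
        using vanish_below_pow[OF assms(1), of k] by (simp add: vanish_below_def)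
    qed
  qed auto
  finally show ?thesis by simp
qed

text \<open>The index is shifted so that \<open>v\<close> has degree \<open>Suc n\<close>, which is
  positive, while the defect starts one degree higher. The factor exp(-v) then preserves all
  coefficients up to length \<open>n\<close>.\<close>

lemma conjugation_step:
  fixes a z G :: "('b::finite, 'k::field_char_0) ser"
  assumes a: "primitive a" "leading_power x 1 a" and z: "primitive z" "leading_power x 1 z"
    and pow: "\<And>\<phi> k m. cyclic \<phi> \<Longrightarrow> pairing m \<phi> (ser_pow a k) = pairing m \<phi> (ser_pow z k)"
    and G: "character G"
    and y: "vanish_below (Suc (Suc n)) (\<lambda>w. ser_mult a G w - ser_mult G z w)"
  shows "\<exists>G'. character G' \<and>
    vanish_below (Suc (Suc (Suc n))) (\<lambda>w. ser_mult a G' w - ser_mult G' z w) \<and>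
    (\<forall>w. length w \<le> n \<longrightarrow> G' w = G w)"
proof -
  let ?N = "Suc (Suc n)"
  define Y where "Y = (\<lambda>w. ser_mult a G w - ser_mult G z w)"
  define u where "u = hpart ?N Y"
  have G0: "G [] = 1" using G by (simp add: character_def)
  have u: "primitive u" unfolding u_def Y_def
    by (rule primitive_conjugation_defect[OF a(1) z(1) G y])
  have u_hom: "u w = 0" if "length w \<noteq> ?N" for w using that by (simp add: u_def hpart_def)
  have u_pw: "u (replicate i x) = 0" for i
  proof (cases "i = 1")
    case True
    then show ?thesis using u_hom[of "replicate i x"] by simp
  qed (rule primitive_power_eq_0[OF u])
  have sum0: "(\<Sum>p | length p = ?N. \<phi> (p @ replicate ?N x) * u p) = 0" if "cyclic \<phi>" for \<phi>
  proof -
    have "(\<Sum>p | length p = ?N. \<phi> (p @ replicate ?N x) * u p) =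
        (\<Sum>p | length p = ?N. \<phi> (p @ replicate ?N x) * (ser_mult a G p - ser_mult G z p))"
      by (intro sum.cong refl) (auto simp: u_def hpart_def Y_def)
    then show ?thesis
      using conjugation_defect_pairing[OF a(2) z(2) G0 y pow[OF that] that, of ?N] by simp
  qed
  have run: "(\<Sum>r\<le>m. u (replicate r x @ q @ replicate (m - r) x)) = 0"
    if "q \<noteq> []" "hd q \<noteq> x" "last q \<noteq> x" for q m
  proof (cases "?N = length q + m")
    case True
    show ?thesis by (rule run_sum_eq_0[OF sum0 that True])
  next
    case False
    then show ?thesis by (intro sum.neutral ballI u_hom) auto
  qed
  obtain v where v: "ser_bracket (letter x) v = u" "\<And>i. v (replicate i x) = 0"
      "\<And>w. length w \<noteq> Suc n \<Longrightarrow> v w = 0"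
    using bracket_letter_solvable[OF u_pw run u_hom] by blast
  have "primitive v" using primitive_of_bracket_letter[of x v] u v by simp
  define c where "c = (\<lambda>w. (- 1) * v w)"
  have c: "primitive c" unfolding c_def by (rule primitive_scale) fact
  have c_van: "vanish_below (Suc n) c" using v(3) by (auto simp: c_def vanish_below_def)
  define e where "e = ser_exp c"
  \<comment> \<open>The part of the exponential beyond its linear term starts in degree
    \<open>2 * Suc n\<close>; multiplied by \<open>a\<close>, it starts above degree
    \<open>?N\<close> and does not affect the step.\<close>
  define r where "r = (\<lambda>w. e w - (ser_one w + c w))"
  have r_van: "vanish_below (2 * Suc n) r"
    using ser_exp_linear_part[OF c_van] by (simp add: r_def e_def vanish_below_def)
  have e_eq: "e = (\<lambda>w. ser_one w + c w + r w)" by (simp add: r_def)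
  have e: "character e" unfolding e_def by (rule character_exp[OF c])
  have e0: "e [] = 1" using e by (simp add: character_def)
  define G' where "G' = ser_mult e G"
  have G': "character G'" unfolding G'_def using e G by (rule character_mult)
  have agree: "G' w = G w" if "length w \<le> n" for w
  proof -
    have "ser_mult e G w = ser_mult ser_one G w"
    proof (rule ser_mult_cong)
      fix s :: "'b list" assume "length s \<le> length w"
      then show "e s = ser_one s"
        using that c_van r_van by (simp add: e_eq vanish_below_def)
    qed simp
    then show ?thesis by (simp add: G'_def)
  qed
  define K where "K = (\<lambda>w. ser_mult a e w - ser_mult e a w)"
  have K_eq: "K w = (ser_mult a c w - ser_mult c a w) + (ser_mult a r w - ser_mult r a w)" for w
    unfolding K_def e_eq by (simp add: ser_mult_linear)
  have a_van: "vanish_below 1 a" by (rule leading_power_vanish[OF a(2)])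
  have l_lead: "leading_power x 1 (letter x)" by (auto simp: leading_power_def letter_def)
  have ar: "ser_mult a r w = 0" "ser_mult r a w = 0" if "length w \<le> ?N" for w
    using vanish_below_mult[OF a_van r_van] vanish_below_mult[OF r_van a_van] that
    by (simp_all add: vanish_below_def)
  have ac_van: "ser_mult a c w = 0" "ser_mult c a w = 0" if "length w < ?N" for w
    using vanish_below_mult[OF a_van c_van] vanish_below_mult[OF c_van a_van] that
    by (simp_all add: vanish_below_def)
  have ac: "ser_mult a c w = - ser_mult (letter x) v w" "ser_mult c a w = - ser_mult v (letter x) w"
    if "length w = ?N" for w
  proof -
    have al: "a s = letter x s" if "length s = 1" for s
      using that a(2) by (simp add: leading_power_def letter_def)
    have v_van: "vanish_below (Suc n) v" using v(3) by (auto simp: vanish_below_def)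
    show "ser_mult a c w = - ser_mult (letter x) v w"
      using ser_mult_lowest[OF a_van c_van, of w] that al[of "take 1 w"]
        ser_mult_lowest[OF leading_power_vanish[OF l_lead] v_van, of w]
      by (simp add: c_def)
    show "ser_mult c a w = - ser_mult v (letter x) w"
      using ser_mult_lowest[OF c_van a_van, of w] that al[of "drop (Suc n) w"]
        ser_mult_lowest[OF v_van leading_power_vanish[OF l_lead], of w]
      by (simp add: c_def)
  qed
  have K_van: "vanish_below ?N K" using K_eq ar ac_van by (simp add: vanish_below_def)
  have K_low: "K w = - u w" if "length w = ?N" for w
    using K_eq[of w] ar[of w] ac[of w] that v(1)[symmetric]
    by (simp add: ser_bracket_def ser_minus_def)
  have Y_van: "vanish_below ?N Y" using y by (simp add: Y_def)
  \<comment> \<open>In degree \<open>?N\<close> the first summand contributes \<open>u\<close> and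
    the commutator \<open>K\<close> contributes \<open>- u\<close>.\<close>
  have decomp: "ser_mult a G' w - ser_mult G' z w = ser_mult e Y w + ser_mult K G w" for w
    by (simp add: G'_def Y_def K_def ser_mult_linear ser_mult_assoc)
  have "ser_mult a G' w - ser_mult G' z w = 0" if w: "length w < Suc ?N" for w
  proof (cases "length w = ?N")
    case True
    have "ser_mult e Y w = Y w"
      using ser_mult_lowest[of 0 e ?N Y w] Y_van True e0 by simp
    moreover have "ser_mult K G w = K w"
      using ser_mult_lowest[of ?N K 0 G w] K_van True G0 by simp
    ultimately show ?thesis using decomp K_low True by (simp add: u_def hpart_def)
  next
    case False
    then show ?thesis
      using decomp vanish_below_mult[of 0 e ?N Y] vanish_below_mult[of ?N K 0 G] Y_van K_van w
      by (simp add: vanish_below_def)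
  qed
  then show ?thesis using G' agree unfolding vanish_below_def by blast
qed

lemma conjugate_of_leading_letter:
  fixes a z :: "('b::finite, 'k::field_char_0) ser"
  assumes a: "primitive a" and z: "primitive z" "leading_power x 1 z"
    and eq: "cyc_eq (ser_exp a) (ser_exp z)"
  shows "\<exists>g h. character g \<and> ser_mult g h = ser_one \<and> ser_mult h g = ser_one \<and>
    a = ser_mult (ser_mult g z) h"
proof -
  note pow = pairing_pow_eq[OF a z(1) _ eq]
  \<comment> \<open>The indicator of a one-letter word is cyclic, so the case k = 1 of
    \<open>pow\<close> compares linear parts directly.\<close>
  have lin: "a [b] = z [b]" for b
  proof -
    have cyc: "cyclic (\<lambda>w. if w = [b] then 1 else 0 :: 'k)" by (auto simp: cyclic_def)
    have "pairing 1 (\<lambda>w. if w = [b] then 1 else 0) f = f [b]" for f :: "('b, 'k) ser"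
      unfolding pairing_def
      by (subst sum.mono_neutral_right[OF finite_words, of "{[b]}"]) auto
    then show ?thesis using pow[OF cyc, of 1 1] by simp
  qed
  have lead_a: "leading_power x 1 a"
    unfolding leading_power_def
  proof (intro allI impI)
    fix w :: "'b list" assume le: "length w \<le> 1"
    have "a w = z w"
    proof (cases w)
      case Nil
      then show ?thesis using primitive_Nil[OF a] primitive_Nil[OF z(1)] by simp
    next
      case (Cons b v)
      then show ?thesis using le lin by simp
    qed
    then show "a w = (if w = replicate 1 x then 1 else 0)"
      using z(2) le by (simp add: leading_power_def)
  qed
  have "\<exists>X. \<forall>n. (character (X n) \<and>
      vanish_below (Suc (Suc n)) (\<lambda>w. ser_mult a (X n) w - ser_mult (X n) z w)) \<and>
      (\<forall>w. length w \<le> n \<longrightarrow> X (Suc n) w = X n w)"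
  proof (rule dependent_nat_choice)
    have "vanish_below (Suc (Suc 0)) (\<lambda>w. a w - z w)"
      using lead_a z(2) by (simp add: leading_power_def vanish_below_def)
    then show "\<exists>G. character G \<and>
        vanish_below (Suc (Suc 0)) (\<lambda>w. ser_mult a G w - ser_mult G z w)"
      using character_one by (intro exI[of _ ser_one]) simp
  next
    fix G n
    assume "character G \<and> vanish_below (Suc (Suc n)) (\<lambda>w. ser_mult a G w - ser_mult G z w)"
    then show "\<exists>G'. (character G' \<and>
        vanish_below (Suc (Suc (Suc n))) (\<lambda>w. ser_mult a G' w - ser_mult G' z w)) \<and>
        (\<forall>w. length w \<le> n \<longrightarrow> G' w = G w)"
      using conjugation_step[OF a lead_a z pow] by blast
  qed
  then obtain X where X: "\<And>n. character (X n)"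
      "\<And>n. vanish_below (Suc (Suc n)) (\<lambda>w. ser_mult a (X n) w - ser_mult (X n) z w)"
      "\<And>n w. length w \<le> n \<Longrightarrow> X (Suc n) w = X n w"
    by blast
  define g where "g w = X (length w) w" for w
  have lim: "X n w = g w" if "length w \<le> n" for n w
    unfolding g_def using stable_sequence_limit[of X, OF X(3) that] .
  have g: "character g" using character_limit[of X, OF X(1) lim] by blast
  have ag: "ser_mult a g = ser_mult g z"
  proof
    fix w
    have "ser_mult a g w = ser_mult a (X (length w)) w" "ser_mult g z w = ser_mult (X (length w)) z w"
      by (auto intro!: ser_mult_cong simp: lim)
    then show "ser_mult a g w = ser_mult g z w"
      using X(2)[of "length w"] by (simp add: vanish_below_def)
  qed
  have "g [] = 1" using g by (simp add: character_def)
  then obtain h where h: "ser_mult g h = ser_one" "ser_mult h g = ser_one"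
    using ser_inverse_exists by blast
  have "a = ser_mult (ser_mult g z) h"
    unfolding ag[symmetric] by (simp add: ser_mult_assoc h)
  then show ?thesis using g h by blast
qed

subsection \<open>Linear changes of variables\<close>

text \<open>The algebra endomorphism that sends the letter b to the sum of \<open>M b c\<close> times c.\<close>

primrec subst_word :: "'b list \<Rightarrow> ('b::finite \<Rightarrow> 'b \<Rightarrow> 'k::field) \<Rightarrow> ('b, 'k) ser \<Rightarrow> 'k" where
  "subst_word [] M f = f []"
| "subst_word (c # w) M f = (\<Sum>b\<in>UNIV. M b c * subst_word w M (\<lambda>v. f (b # v)))"

definition lin_subst :: "('b::finite \<Rightarrow> 'b \<Rightarrow> 'k::field) \<Rightarrow> ('b, 'k) ser \<Rightarrow> ('b, 'k) ser" where
  "lin_subst M f w = subst_word w M f"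

lemma lin_subst_Nil [simp]: "lin_subst M f [] = f []"
  by (simp add: lin_subst_def)

lemma lin_subst_Cons:
  "lin_subst M f (c # w) = (\<Sum>b\<in>UNIV. M b c * lin_subst M (\<lambda>v. f (b # v)) w)"
  by (simp add: lin_subst_def)

lemma lin_subst_cong:
  "(\<And>v. length v = length w \<Longrightarrow> f v = g v) \<Longrightarrow> lin_subst M f w = lin_subst M g w"
proof (induction w arbitrary: f g)
  case (Cons c w)
  have "lin_subst M (\<lambda>v. f (b # v)) w = lin_subst M (\<lambda>v. g (b # v)) w" for b
    using Cons.prems by (intro Cons.IH) simp
  then show ?case by (simp add: lin_subst_Cons)
qed simp

lemma lin_subst_add: "lin_subst M (\<lambda>v. f v + g v) w = lin_subst M f w + lin_subst M g w"
  by (induction w arbitrary: f g) (simp_all add: lin_subst_Cons distrib_left sum.distrib)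

lemma lin_subst_scale: "lin_subst M (\<lambda>v. c * f v) w = c * lin_subst M f w"
  by (induction w arbitrary: f) (simp_all add: lin_subst_Cons sum_distrib_left mult.left_commute)

lemma lin_subst_diff: "lin_subst M (\<lambda>v. f v - g v) w = lin_subst M f w - lin_subst M g w"
  using lin_subst_add[of M f "\<lambda>v. (- 1) * g v" w] lin_subst_scale[of M "- 1" g w] by simp

lemma lin_subst_zero [simp]: "lin_subst M (\<lambda>v. 0) w = 0"
  using lin_subst_scale[of M 0 "\<lambda>v. 0" w] by simp

lemma lin_subst_sum: "lin_subst M (\<lambda>v. \<Sum>i\<in>A. f i v) w = (\<Sum>i\<in>A. lin_subst M (f i) w)"
  by (induction A rule: infinite_finite_induct) (simp_all add: lin_subst_add)

lemma lin_subst_mult: "lin_subst M (ser_mult f g) = ser_mult (lin_subst M f) (lin_subst M g)"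
proof
  fix w show "lin_subst M (ser_mult f g) w = ser_mult (lin_subst M f) (lin_subst M g) w"
  proof (induction w arbitrary: f)
    case (Cons c w)
    have "(\<lambda>v. lin_subst M f (c # v)) = (\<lambda>v. \<Sum>b\<in>UNIV. M b c * lin_subst M (\<lambda>v. f (b # v)) v)"
      by (simp add: lin_subst_Cons)
    then show ?case
      by (simp add: lin_subst_Cons ser_mult_Cons lin_subst_add lin_subst_scale Cons.IH
          ser_mult_sum_left ser_mult_scale_left distrib_left sum.distrib sum_distrib_left
          mult.left_commute)
  qed simp
qed

lemma lin_subst_one: "lin_subst M ser_one = ser_one"
proof
  fix w show "lin_subst M ser_one w = ser_one w"
    by (cases w) (simp_all add: lin_subst_Cons ser_one_def)
qed

lemma lin_subst_pow: "lin_subst M (ser_pow f n) = ser_pow (lin_subst M f) n"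
  by (induction n) (simp_all add: lin_subst_one lin_subst_mult)

lemma lin_subst_exp: "lin_subst M (ser_exp f) = ser_exp (lin_subst M f)"
proof
  fix w
  have "lin_subst M (ser_exp f) w =
      lin_subst M (\<lambda>v. \<Sum>n\<le>length w. (1 / fact n) * ser_pow f n v) w"
    by (rule lin_subst_cong) (simp add: ser_exp_def)
  also have "\<dots> = (\<Sum>n\<le>length w. (1 / fact n) * ser_pow (lin_subst M f) n w)"
    by (simp only: lin_subst_sum lin_subst_scale lin_subst_pow)
  finally show "lin_subst M (ser_exp f) w = ser_exp (lin_subst M f) w"
    by (simp add: ser_exp_def)
qed

lemma lin_subst_bracket:
  "lin_subst M (ser_bracket f g) = ser_bracket (lin_subst M f) (lin_subst M g)"
  by (simp add: fun_eq_iff ser_bracket_def ser_minus_def lin_subst_diff lin_subst_mult)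

lemma lin_subst_comp:
  "lin_subst N (lin_subst M f) = lin_subst (\<lambda>b d. \<Sum>c\<in>UNIV. M b c * N c d) f"
proof
  fix w show "lin_subst N (lin_subst M f) w = lin_subst (\<lambda>b d. \<Sum>c\<in>UNIV. M b c * N c d) f w"
  proof (induction w arbitrary: f)
    case (Cons d w)
    have "lin_subst N (lin_subst M f) (d # w) = (\<Sum>c\<in>UNIV. N c d *
        lin_subst N (\<lambda>v. \<Sum>b\<in>UNIV. M b c * lin_subst M (\<lambda>u. f (b # u)) v) w)"
      by (simp add: lin_subst_Cons)
    also have "\<dots> = (\<Sum>c\<in>UNIV. \<Sum>b\<in>UNIV. M b c * N c d *
        lin_subst (\<lambda>b d. \<Sum>c\<in>UNIV. M b c * N c d) (\<lambda>u. f (b # u)) w)"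
      by (simp add: lin_subst_sum lin_subst_scale Cons.IH sum_distrib_left mult_ac)
    also have "\<dots> = (\<Sum>b\<in>UNIV. \<Sum>c\<in>UNIV. M b c * N c d *
        lin_subst (\<lambda>b d. \<Sum>c\<in>UNIV. M b c * N c d) (\<lambda>u. f (b # u)) w)"
      by (rule sum.swap)
    finally show ?case by (simp add: lin_subst_Cons sum_distrib_right)
  qed simp
qed

lemma lin_subst_id: "lin_subst (\<lambda>b d. if b = d then 1 else 0) f = f"
proof
  fix w show "lin_subst (\<lambda>b d. if b = d then 1 else 0) f w = f w"
    by (induction w arbitrary: f) (simp_all add: lin_subst_Cons if_distrib[of "\<lambda>x. x * _"] cong: if_cong)
qed

lemma lin_subst_letter: "lin_subst M (letter b) = (\<lambda>w. \<Sum>c\<in>UNIV. M b c * letter c w)"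
proof
  fix w
  have cons: "(\<lambda>v. letter b (d # v)) = (\<lambda>v. if d = b then ser_one v else 0 :: 'b)" for d
    by (auto simp: letter_def ser_one_def)
  show "lin_subst M (letter b) w = (\<Sum>c\<in>UNIV. M b c * letter c w)"
  proof (cases w)
    case Nil
    then show ?thesis by (simp add: letter_def)
  next
    case (Cons c v)
    have "lin_subst M (letter b) w = M b c * ser_one v"
      unfolding Cons lin_subst_Cons cons
      by (subst sum.remove[of _ b]) (auto simp: lin_subst_one intro!: sum.neutral)
    also have "\<dots> = (\<Sum>d\<in>UNIV. M b d * letter d w)"
      unfolding Cons by (subst sum.remove[of _ c])
        (auto simp: letter_def ser_one_def intro!: sum.neutral)
    finally show ?thesis .
  qed
qed

text \<open>Transport takes place on the Lie side, where the substitution respects brackets and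
  sends letters to combinations of letters; primitivity of the image is deduced from it.\<close>

lemma lin_subst_lie_hom: "lie_hom m f \<Longrightarrow> lie_hom m (lin_subst M f)"
proof (induction rule: lie_hom.induct)
  case (lie_zero m)
  have "lin_subst M ser_zero = ser_zero" by (simp add: ser_zero_def fun_eq_iff)
  then show ?case by (simp add: lie_hom.lie_zero)
next
  case (lie_letter b)
  then show ?case
    unfolding lin_subst_letter
    by (intro lie_hom_sum lie_smult[OF lie_hom.lie_letter, unfolded ser_smult_def])
next
  case (lie_add m x y)
  then show ?case
    using lie_hom.lie_add[of m "lin_subst M x" "lin_subst M y"]
    by (simp add: ser_add_def lin_subst_add[abs_def])
next
  case (lie_smult m x c)
  then show ?case
    using lie_hom.lie_smult[of m "lin_subst M x" c]
    by (simp add: ser_smult_def lin_subst_scale[abs_def])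
next
  case (lie_br p x q y)
  then show ?case by (simp add: lin_subst_bracket lie_hom.lie_br)
qed

lemma lin_subst_hpart: "hpart m (lin_subst M f) = lin_subst M (hpart m f)"
proof
  fix w
  show "hpart m (lin_subst M f) w = lin_subst M (hpart m f) w"
  proof (cases "length w = m")
    case True
    then have "lin_subst M (hpart m f) w = lin_subst M f w"
      by (intro lin_subst_cong) (simp add: hpart_def)
    then show ?thesis using True by (simp add: hpart_def)
  next
    case False
    then have "lin_subst M (hpart m f) w = lin_subst M (\<lambda>v. 0) w"
      by (intro lin_subst_cong) (simp add: hpart_def)
    then show ?thesis using False by (simp add: hpart_def)
  qed
qed

lemma lin_subst_free_lie_hat: "f \<in> free_lie_hat \<Longrightarrow> lin_subst M f \<in> free_lie_hat"
  by (simp add: free_lie_hat_def lin_subst_hpart lin_subst_lie_hom)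

lemma lin_subst_grouplike: "g \<in> grouplike \<Longrightarrow> lin_subst M g \<in> grouplike"
  by (auto simp: grouplike_def lin_subst_exp lin_subst_free_lie_hat)

lemma lin_subst_comm_span: "comm_span c \<Longrightarrow> comm_span (lin_subst M c)"
proof (induction rule: comm_span.induct)
  case cs_zero
  have "lin_subst M ser_zero = ser_zero" by (simp add: ser_zero_def fun_eq_iff)
  then show ?case by (simp add: comm_span.cs_zero)
next
  case (cs_comm x y)
  then show ?case by (simp add: lin_subst_bracket comm_span.cs_comm)
next
  case (cs_add x y)
  then show ?case
    using comm_span.cs_add[of "lin_subst M x" "lin_subst M y"]
    by (simp add: ser_add_def lin_subst_add[abs_def])
next
  case (cs_smult x c)
  then show ?case
    using comm_span.cs_smult[of "lin_subst M x" c]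
    by (simp add: ser_smult_def lin_subst_scale[abs_def])
qed

lemma lin_subst_cyc_eq:
  assumes "cyc_eq f g"
  shows "cyc_eq (lin_subst M f) (lin_subst M g)"
  unfolding cyc_eq_def in_closure_def
proof
  fix N
  obtain c where c: "comm_span c" "\<And>w. length w \<le> N \<Longrightarrow> ser_minus f g w = c w"
    using assms unfolding cyc_eq_def in_closure_def by blast
  have "ser_minus (lin_subst M f) (lin_subst M g) w = lin_subst M c w" if "length w \<le> N" for w
  proof -
    have "ser_minus (lin_subst M f) (lin_subst M g) w = lin_subst M (ser_minus f g) w"
      by (simp add: ser_minus_def lin_subst_diff)
    also have "\<dots> = lin_subst M c w"
      by (rule lin_subst_cong) (simp add: c that)
    finally show ?thesis .
  qed
  then show "\<exists>c. comm_span c \<and>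
      (\<forall>w. length w \<le> N \<longrightarrow> ser_minus (lin_subst M f) (lin_subst M g) w = c w)"
    using lin_subst_comm_span[OF c(1)] by blast
qed

lemma straighten_linear_part:
  fixes z :: "('b::finite, 'k::field) ser"
  assumes "z [x] \<noteq> 0"
  shows "\<exists>N M. (\<forall>f. lin_subst N (lin_subst M f) = f) \<and>
    (\<forall>c. lin_subst M z [c] = (if c = x then 1 else 0))"
proof -
  \<comment> \<open>\<open>N\<close> sends \<open>x\<close> to the linear part of \<open>z\<close>
    and fixes the other letters. \<open>M\<close> is the inverse matrix, available because
    \<open>z [x] \<noteq> 0\<close>, so it takes that linear part back to \<open>x\<close>.\<close>
  define M where "M b c = (if b = x then (if c = x then 1 else - z [c]) / z [x]
      else if b = c then 1 else 0)" for b c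
  define N where "N b c = (if b = x then z [c] else if b = c then 1 else 0)" for b c
  have split: "(\<Sum>b\<in>UNIV. F b) = F x + (\<Sum>b\<in>UNIV - {x}. F b)" for F :: "'b \<Rightarrow> 'k"
    by (simp add: sum.remove[of UNIV x])
  have delta: "(\<Sum>b\<in>UNIV - {x}. F b * (if b = c then 1 else 0)) = (if c = x then 0 else F c)"
    for F :: "'b \<Rightarrow> 'k" and c
    by (auto simp: if_distrib[of "\<lambda>y. _ * y"] cong: if_cong)
  have restN: "(\<Sum>b\<in>UNIV - {x}. F b * N b c) = (if c = x then 0 else F c)" for F c
    unfolding delta[symmetric] by (intro sum.cong) (auto simp: N_def)
  have restM: "(\<Sum>b\<in>UNIV - {x}. M b c * F b) = (if c = x then 0 else F c)" for F c
    unfolding delta[symmetric] by (intro sum.cong) (auto simp: M_def)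
  have MN: "(\<Sum>c\<in>UNIV. M b c * N c d) = (if b = d then 1 else 0)" for b d
    unfolding split restN using assms by (simp add: M_def N_def)
  have 1: "lin_subst N (lin_subst M f) = f" for f
    unfolding lin_subst_comp MN by (rule lin_subst_id)
  have 2: "lin_subst M z [c] = (if c = x then 1 else 0)" for c
    unfolding lin_subst_Cons lin_subst_Nil split restM using assms by (simp add: M_def)
  show ?thesis by (intro exI conjI allI) (rule 1, rule 2)
qed

theorem theorem3p4:
  fixes z a :: "('b::finite, 'k::field_char_0) ser"
  assumes "z \<in> free_lie_hat"
    and "\<not> (\<forall>l\<le>1. hpart l z = ser_zero)"
    and "a \<in> free_lie_hat"
    and "cyc_eq (ser_exp a) (ser_exp z)"
  shows "\<exists>g\<in>grouplike. \<exists>h. ser_mult g h = ser_one \<and> ser_mult h g = ser_one \<and>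
           a = ser_mult (ser_mult g z) h"
proof -
  have z0: "z [] = 0" using primitive_Nil[OF free_lie_hat_imp_primitive[OF assms(1)]] .
  have "\<exists>x. z [x] \<noteq> 0"
  proof (rule ccontr)
    assume "\<nexists>x. z [x] \<noteq> 0"
    then have "z w = 0" if "length w \<le> 1" for w
      using that z0 by (cases w) auto
    then have "hpart l z = ser_zero" if "l \<le> 1" for l
      using that by (simp add: hpart_def ser_zero_def fun_eq_iff)
    then show False using assms(2) by simp
  qed
  then obtain x where x: "z [x] \<noteq> 0" by blast
  obtain N M where NM: "(\<forall>f. lin_subst N (lin_subst M f) = f) \<and>
      (\<forall>c. lin_subst M z [c] = (if c = x then 1 else 0))"
    using straighten_linear_part[of z x, OF x] by (elim exE)
  note MN = conjunct1[OF NM, rule_format] and lead = conjunct2[OF NM, rule_format]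
  have lead_z: "leading_power x 1 (lin_subst M z)"
    unfolding leading_power_def
  proof (intro allI impI)
    fix w :: "'b list" assume "length w \<le> 1"
    then consider "w = []" | c where "w = [c]" by (cases w) auto
    then show "lin_subst M z w = (if w = replicate 1 x then 1 else 0)"
      by cases (simp_all add: z0 lead)
  qed
  have "cyc_eq (ser_exp (lin_subst M a)) (ser_exp (lin_subst M z))"
    using lin_subst_cyc_eq[OF assms(4)] by (simp add: lin_subst_exp)
  \<comment> \<open>The conjugator is found in the new coordinates as a character; the substitution
    \<open>N\<close> then carries the whole identity back, once the character is recognised as an
    exponential of a Lie series.\<close>
  from conjugate_of_leading_letter[OF _ _ lead_z this]
  obtain g h where gh: "character g" "ser_mult g h = ser_one" "ser_mult h g = ser_one"
      "lin_subst M a = ser_mult (ser_mult g (lin_subst M z)) h"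
    using assms(1,3)[THEN lin_subst_free_lie_hat, THEN free_lie_hat_imp_primitive] by blast
  have "a = lin_subst N (ser_mult (ser_mult g (lin_subst M z)) h)"
    unfolding gh(4)[symmetric] MN ..
  then have a: "a = ser_mult (ser_mult (lin_subst N g) z) (lin_subst N h)"
    unfolding lin_subst_mult MN .
  have "ser_mult (lin_subst N g) (lin_subst N h) = ser_one"
    "ser_mult (lin_subst N h) (lin_subst N g) = ser_one"
    unfolding lin_subst_mult[symmetric] gh lin_subst_one by (rule refl)+
  then show ?thesis
    using a lin_subst_grouplike[OF character_grouplike[OF gh(1)], of N] by blast
qed

end
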